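(* Let $n\ge 2$. Let $Y=\{s_1,\dots,s_{n-1},e,t\}$ be an alphabet, and let $\psi:Y^*\to\mathcal P_n^{\mathrm{fd}}$ be the monoid morphism determined by $s_i\mapsto\underline s_i$, $e\mapsto\underline e$, $t\mapsto\underline t$. Let $Q$ be the following set of relations over $Y$, where $\iota$ is the empty word and $w=s_2s_3s_1s_2$: $$s_i^2=\iota,\qquad s_is_j=s_js_i\ \text{ if }|i-j|>1,\qquad s_is_js_i=s_js_is_j\ \text{ if }|i-j|=1,$$ $$t^2=t=et=s_1t,\qquad e^2=e=te=s_1e=es_1,$$ $$s_it=ts_i\ \text{ if } i>2,\qquad s_ie=es_i\ \text{ if } i>2,$$ $$ts_1s_2t=ts_1s_2s_1,\qquad ts_2ts_2=s_2ts_2t,\qquad es_2es_2=s_2es_2e,\qquad ts_2es_2=s_2es_2t,$$ $$twtw=wtwt,\qquad ewew=wewe,\qquad twew=wewt$$ (relations involving a letter $s_i$ with $i\geq n$ being omitted). Then the monoid $\mathcal P_n^{\mathrm{fd}}$ has monoid presentation $\langle Y:Q\rangle$ via $\psi$.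
   Context: Partition monoid: let $\mathbf n=\{1,\dots,n\}$, and let $\mathbf n'=\{1',\dots,n'\}$ and $\mathbf n''=\{1'',\dots,n''\}$ be disjoint copies of $\mathbf n$. The partition monoid $\mathcal P_n$ is the set of all set partitions of $\mathbf n\cup\mathbf n'$, with product defined as follows. For $a,b\in\mathcal P_n$, let $a^\downarrow$ be the partition of $\mathbf n\cup\mathbf n''$ obtained from $a$ by renaming each $x'$ as $x''$, and $b^\uparrow$ the partition of $\mathbf n''\cup\mathbf n'$ obtained from $b$ by renaming each $x\in\mathbf n$ as $x''$. Then $x,y\in\mathbf n\cup\mathbf n'$ belong to the same block of $ab$ iff they are related by the smallest equivalence relation on $\mathbf n\cup\mathbf n''\cup\mathbf n'$ that relates any two elements lying in a common block of $a^\downarrow$ or of $b^\uparrow$. The identity is the partition $1$ with blocks $\{x,x'\}$, $x\in\mathbf n$. The full-domain partition monoid $\mathcal P_n^{\mathrm{fd}}$ is the submonoid of all $a\in\mathcal P_n$ such that every element of $\mathbf n$ lies in a block containing at least one element of $\mathbf n'$. The images of the generators are: $\underline s_i$ ($1\le i\le n-1$) has blocks $\{i,(i+1)'\}$, $\{i+1,i'\}$ and $\{x,x'\}$ for $x\ne i,i+1$; $\underline t$ has blocks $\{1,2,1'\}$, $\{2'\}$ and $\{x,x'\}$ for $x\ge3$; $\underline e$ has blocks $\{1,2,1',2'\}$ and $\{x,x'\}$ for $x\ge 3$. Presentations: $Y^*$ is the free monoid over $Y$. A relation $u=v$ stands for the pair $(u,v)$. A monoid $M$ has monoid presentation $\langle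 Y:Q\rangle$ via $\psi:Y^*\to M$ if $\psi$ is a surjective monoid morphism whose kernel $\{(u,v):u\psi=v\psi\}$ is the congruence on $Y^*$ generated by $Q$. *)

theory Defs
  imports "HOL-Algebra.Group" "HOL-Library.Disjoint_Sets"
begin

section \<open>Monoid presentations\<close>

definition free_monoid :: "'y set \<Rightarrow> 'y list monoid" where
  "free_monoid Y = \<lparr>carrier = lists Y, mult = (@), one = []\<rparr>"

inductive_set generated_congruence :: "('a, 'm) monoid_scheme \<Rightarrow> ('a \<times> 'a) set \<Rightarrow> ('a \<times> 'a) set"
  for M (structure) and Q where
  base: "(u, v) \<in> Q \<Longrightarrow> (u, v) \<in> generated_congruence M Q"
| refl: "u \<in> carrier M \<Longrightarrow> (u, u) \<in> generated_congruence M Q"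
| sym: "(u, v) \<in> generated_congruence M Q \<Longrightarrow> (v, u) \<in> generated_congruence M Q"
| trans: "(u, v) \<in> generated_congruence M Q \<Longrightarrow> (v, w) \<in> generated_congruence M Q
    \<Longrightarrow> (u, w) \<in> generated_congruence M Q"
| mult: "(u, v) \<in> generated_congruence M Q \<Longrightarrow> (u', v') \<in> generated_congruence M Q
    \<Longrightarrow> (u \<otimes> u', v \<otimes> v') \<in> generated_congruence M Q"

text \<open>
  The set \<open>hom\<close> does not require preservation of the identity, hence the separate conjunct.
\<close>
definition has_monoid_presentation ::
    "('a, 'm) monoid_scheme \<Rightarrow> 'y set \<Rightarrow> ('y list \<times> 'y list) set \<Rightarrow> ('y list \<Rightarrow> 'a) \<Rightarrow> bool" where
  "has_monoid_presentation M Y Q \<psi> \<longleftrightarrow>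
     monoid M \<and>
     Q \<subseteq> lists Y \<times> lists Y \<and>
     \<psi> \<in> hom (free_monoid Y) M \<and> \<psi> [] = \<one>\<^bsub>M\<^esub> \<and>
     \<psi> ` lists Y = carrier M \<and>
     {(u, v). u \<in> lists Y \<and> v \<in> lists Y \<and> \<psi> u = \<psi> v} = generated_congruence (free_monoid Y) Q"

text \<open>The morphism from words to \<open>M\<close> determined by the images \<open>f\<close> of the letters.\<close>
definition word_morphism :: "('a, 'm) monoid_scheme \<Rightarrow> ('y \<Rightarrow> 'a) \<Rightarrow> 'y list \<Rightarrow> 'a" where
  "word_morphism M f u = foldr (\<lambda>y a. f y \<otimes>\<^bsub>M\<^esub> a) u \<one>\<^bsub>M\<^esub>"

section \<open>Partition monoids\<close>

text \<open>
  \<open>Top x\<close>, \<open>Bot x\<close> and \<open>Mid x\<close> stand for \<open>x\<close>, \<open>x'\<close> and \<open>x''\<close>, for \<open>x\<close> in \<open>{1..n}\<close>.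
\<close>
datatype point = Top nat | Mid nat | Bot nat

definition points :: "nat \<Rightarrow> point set" where
  "points n = Top ` {1..n} \<union> Bot ` {1..n}"

fun bot_to_mid :: "point \<Rightarrow> point" where
  "bot_to_mid (Top x) = Top x"
| "bot_to_mid (Mid x) = Mid x"
| "bot_to_mid (Bot x) = Mid x"

fun top_to_mid :: "point \<Rightarrow> point" where
  "top_to_mid (Top x) = Mid x"
| "top_to_mid (Mid x) = Mid x"
| "top_to_mid (Bot x) = Bot x"

definition down :: "point set set \<Rightarrow> point set set" where
  "down a = (`) bot_to_mid ` a"

definition up :: "point set set \<Rightarrow> point set set" where
  "up b = (`) top_to_mid ` b"

text \<open>
  \<open>equivclp\<close> is reflexive on all of \<open>point\<close>, not just on the three copies of \<open>{1..n}\<close>;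
  this makes no difference to how points of the three copies are related.
\<close>
definition connected_in_product :: "point set set \<Rightarrow> point set set \<Rightarrow> point \<Rightarrow> point \<Rightarrow> bool" where
  "connected_in_product a b = equivclp (\<lambda>x y. \<exists>B \<in> down a \<union> up b. x \<in> B \<and> y \<in> B)"

definition partition_mult :: "nat \<Rightarrow> point set set \<Rightarrow> point set set \<Rightarrow> point set set" where
  "partition_mult n a b = (\<lambda>x. {y \<in> points n. connected_in_product a b x y}) ` points n"

definition partition_one :: "nat \<Rightarrow> point set set" where
  "partition_one n = (\<lambda>x. {Top x, Bot x}) ` {1..n}"

definition partition_monoid :: "nat \<Rightarrow> point set set monoid" where
  "partition_monoid n =
     \<lparr>carrier = {a. partition_on (points n) a}, mult = partition_mult n, one = partition_one n\<rparr>"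

definition full_domain_partition_monoid :: "nat \<Rightarrow> point set set monoid" where
  "full_domain_partition_monoid n = (partition_monoid n)
     \<lparr>carrier := {a \<in> carrier (partition_monoid n).
        \<forall>x \<in> {1..n}. \<exists>B \<in> a. Top x \<in> B \<and> (\<exists>y \<in> {1..n}. Bot y \<in> B)}\<rparr>"

section \<open>Generators and relations\<close>

datatype letter = S nat | E | T

definition alphabet :: "nat \<Rightarrow> letter set" where
  "alphabet n = {S i | i. 1 \<le> i \<and> i < n} \<union> {E, T}"

fun generator :: "nat \<Rightarrow> letter \<Rightarrow> point set set" where
  "generator n (S i) =
     {{Top i, Bot (i + 1)}, {Top (i + 1), Bot i}} \<union> (\<lambda>x. {Top x, Bot x}) ` ({1..n} - {i, i + 1})"
| "generator n T = {{Top 1, Top 2, Bot 1}, {Bot 2}} \<union> (\<lambda>x. {Top x, Bot x}) ` {3..n}"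
| "generator n E = {{Top 1, Top 2, Bot 1, Bot 2}} \<union> (\<lambda>x. {Top x, Bot x}) ` {3..n}"

definition presentation_map :: "nat \<Rightarrow> letter list \<Rightarrow> point set set" where
  "presentation_map n = word_morphism (full_domain_partition_monoid n) (generator n)"

definition word_w :: "letter list" where
  "word_w = [S 2, S 3, S 1, S 2]"

text \<open>
  A chain of equalities contributes one pair per equality sign. The schemes below range over
  all indices; the final intersection omits the relations involving some \<open>S i\<close> that is not a
  letter of the alphabet.
\<close>
definition relations :: "nat \<Rightarrow> (letter list \<times> letter list) set" where
  "relations n =
    ({([S i, S i], []) | i. True}
     \<union> {([S i, S j], [S j, S i]) | i j. \<bar>int i - int j\<bar> > 1}
     \<union> {([S i, S j, S i], [S j, S i, S j]) | i j. \<bar>int i - int j\<bar> = 1}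
     \<union> {([T, T], [T]), ([T], [E, T]), ([E, T], [S 1, T])}
     \<union> {([E, E], [E]), ([E], [T, E]), ([T, E], [S 1, E]), ([S 1, E], [E, S 1])}
     \<union> {([S i, T], [T, S i]) | i. i > 2}
     \<union> {([S i, E], [E, S i]) | i. i > 2}
     \<union> {([T, S 1, S 2, T], [T, S 1, S 2, S 1]),
        ([T, S 2, T, S 2], [S 2, T, S 2, T]),
        ([E, S 2, E, S 2], [S 2, E, S 2, E]),
        ([T, S 2, E, S 2], [S 2, E, S 2, T])}
     \<union> {([T] @ word_w @ [T] @ word_w, word_w @ [T] @ word_w @ [T]),
        ([E] @ word_w @ [E] @ word_w, word_w @ [E] @ word_w @ [E]),
        ([T] @ word_w @ [E] @ word_w, word_w @ [E] @ word_w @ [T])})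
    \<inter> lists (alphabet n) \<times> lists (alphabet n)"

end

(*
  An element of the full-domain partition monoid is a self-map f of {1..n} read modulo the
  equivalence relation on {1..n} induced by its lower points. Every word over s, t, e equals, modulo
  the relations, a word over s, t followed by commuting idempotents e_ij (conjugates of e), because
  e_ij u = u e_{iu,ju} for u in s, t. Products of the e_ij depend only on the equivalence they
  generate, and te = e lets them absorb any change of f within that equivalence. It remains to see that
  the relations in s, t present the full transformation monoid. For permutations this is the
  Coxeter presentation. If iu = ju then t_ij u = u, and if z is not in the image of u then
  t_ij u = t_ij v where v agrees with u except that jv = z; hence two words with the same action are
  equal by induction on the number of points outside the image.
*)

theory Submission
  imports Defs "HOL-Combinatorics.Permutations"
begin

section \<open>Encoding by maps and equivalence relations\<close>

text \<open>The relations containing s_2 or w are commutation rules in disguise. Conjugation by s_2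
  moves the pair (1,2) to (1,3), and w, which acts as (1 3)(2 4), moves it to (3,4); so these
  relations let factors at overlapping or disjoint pairs commute. The exception t s_1 s_2 t = t s_1
  s_2 s_1 says t_12 t_23 = t_12 (2 3). Two pairs involve at most four points, so all other cases are
  conjugates of these few. A conjugate of t or e depends only on the images of 1 and 2 because s_3,
  s_4, ... commute with t and e. The map f is determined only modulo the lower equivalence.
  Soundness therefore compares maps modulo an equivalence and has to show that this is compatible
  with concatenation. Completeness is proved in an arbitrary monoid satisfying the relations whose
  laws hold on a whole type. The quotient of the word monoid enters only at the end, through a
  Cayley representation by functions, which supplies such a monoid.\<close>

definition eqv :: "'a rel \<Rightarrow> 'a \<Rightarrow> 'a \<Rightarrow> bool" where
  "eqv L = equivclp (\<lambda>i j. (i, j) \<in> L)"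

lemma eqv_refl [simp]: "eqv L x x"
  by (simp add: eqv_def)

lemma eqv_sym: "eqv L x y \<Longrightarrow> eqv L y x"
  unfolding eqv_def by (rule equivclp_sym)

lemma eqv_trans: "eqv L x y \<Longrightarrow> eqv L y z \<Longrightarrow> eqv L x z"
  unfolding eqv_def by (rule equivclp_trans)

lemma eqv_base: "(x, y) \<in> L \<Longrightarrow> eqv L x y"
  unfolding eqv_def by (rule r_into_equivclp)

lemma eqv_least:
  assumes "eqv L x y"
    and "\<And>x y. (x, y) \<in> L \<Longrightarrow> R x y" "\<And>x. R x x" "\<And>x y. R x y \<Longrightarrow> R y x"
      "\<And>x y z. R x y \<Longrightarrow> R y z \<Longrightarrow> R x z"
  shows "R x y"
  using assms(1) unfolding eqv_def
  by (induction rule: equivclp_induct) (use assms(2-) in blast)+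

lemma eqv_map:
  assumes "eqv L x y" and "\<And>x y. (x, y) \<in> L \<Longrightarrow> eqv M (h x) (h y)"
  shows "eqv M (h x) (h y)"
  using assms(1) by (rule eqv_least) (auto intro: assms(2) eqv_sym eqv_trans)

lemma eqv_mono:
  assumes "eqv L x y" and "\<And>x y. (x, y) \<in> L \<Longrightarrow> eqv M x y"
  shows "eqv M x y"
  using eqv_map[of L x y M "\<lambda>x. x"] assms by simp

text \<open>
  An element of the full-domain partition monoid is encoded by a map \<open>f\<close> and a relation \<open>L\<close> on
  \<open>{1..n}\<close>: \<open>L\<close> generates the equivalence induced on the lower points, and \<open>f\<close> sends each upper
  point to some lower point of its block.
\<close>

fun lower_point :: "(nat \<Rightarrow> nat) \<Rightarrow> point \<Rightarrow> nat" where
  "lower_point f (Top x) = f x"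
| "lower_point f (Mid x) = x"
| "lower_point f (Bot x) = x"

definition encoded :: "nat \<Rightarrow> (nat \<Rightarrow> nat) \<Rightarrow> nat rel \<Rightarrow> point set set" where
  "encoded n f L = (\<lambda>p. {q \<in> points n. eqv L (lower_point f p) (lower_point f q)}) ` points n"

definition same_block :: "point set set \<Rightarrow> point \<Rightarrow> point \<Rightarrow> bool" where
  "same_block a p q \<longleftrightarrow> (\<exists>B\<in>a. p \<in> B \<and> q \<in> B)"

lemma same_block_encoded:
  "same_block (encoded n f L) p q \<longleftrightarrow>
     p \<in> points n \<and> q \<in> points n \<and> eqv L (lower_point f p) (lower_point f q)"
  unfolding same_block_def encoded_def by (auto intro: eqv_sym eqv_trans)

lemma encoded_partition_on: "partition_on (points n) (encoded n f L)"
  unfolding encoded_def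
  by (rule partition_onI) (auto simp: disjnt_def, (meson eqv_sym eqv_trans)+)

text \<open>A block is recovered from any one of its points as the set of points lying with it in a
  common block; nonempty blocks supply the point and disjointness makes the block unique.\<close>

lemma partition_on_eqI:
  assumes "partition_on A a" "partition_on A b"
    and "\<And>p q. (\<exists>B\<in>a. p \<in> B \<and> q \<in> B) \<longleftrightarrow> (\<exists>B\<in>b. p \<in> B \<and> q \<in> B)"
  shows "a = b"
proof -
  have sub: "a \<subseteq> b" if a: "partition_on A a" and b: "partition_on A b"
    and eq: "\<And>p q. (\<exists>B\<in>a. p \<in> B \<and> q \<in> B) \<longleftrightarrow> (\<exists>B\<in>b. p \<in> B \<and> q \<in> B)" for a b
  proof
    fix X assume X: "X \<in> a"
    then obtain p where p: "p \<in> X" using partition_onD3[OF a] by fastforce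
    then obtain Y where Y: "Y \<in> b" "p \<in> Y" using eq[of p p] X by blast
    have "q \<in> X \<longleftrightarrow> q \<in> Y" for q
    proof -
      have "q \<in> X \<longleftrightarrow> (\<exists>B\<in>a. p \<in> B \<and> q \<in> B)"
        using X p partition_onD2[OF a] by (fastforce simp: disjoint_def)
      also have "\<dots> \<longleftrightarrow> q \<in> Y"
        unfolding eq using Y partition_onD2[OF b] by (fastforce simp: disjoint_def)
      finally show ?thesis .
    qed
    then show "X \<in> b" using Y by (metis subsetI subset_antisym)
  qed
  show ?thesis
    using sub[OF assms] sub[OF assms(2,1) assms(3)[symmetric]] by (rule equalityI)
qed

text \<open>Together with \<open>encoded_eqD\<close> this measures the ambiguity of the encoding:
  the equivalence on {1..n} is determined, the map only modulo it.\<close>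

lemma encoded_eqI:
  assumes "\<And>i j. i \<in> {1..n} \<Longrightarrow> j \<in> {1..n} \<Longrightarrow> eqv L i j \<longleftrightarrow> eqv M i j"
    and "\<And>i. i \<in> {1..n} \<Longrightarrow> f i \<in> {1..n} \<and> g i \<in> {1..n} \<and> eqv M (f i) (g i)"
  shows "encoded n f L = encoded n g M"
proof (rule partition_on_eqI[OF encoded_partition_on encoded_partition_on])
  fix p q
  have *: "lower_point f r \<in> {1..n} \<and> eqv M (lower_point f r) (lower_point g r)"
    if "r \<in> points n" for r
    using that assms(2) by (auto simp: points_def)
  have "eqv L (lower_point f p) (lower_point f q) \<longleftrightarrow> eqv M (lower_point g p) (lower_point g q)"
    if "p \<in> points n" "q \<in> points n"
  proof -
    have "eqv L (lower_point f p) (lower_point f q) \<longleftrightarrow> eqv M (lower_point f p) (lower_point f q)"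
      using assms(1) * that by blast
    also have "\<dots> \<longleftrightarrow> eqv M (lower_point g p) (lower_point g q)"
      using *[OF that(1)] *[OF that(2)] by (meson eqv_sym eqv_trans)
    finally show ?thesis .
  qed
  then have "same_block (encoded n f L) p q \<longleftrightarrow> same_block (encoded n g M) p q"
    by (simp only: same_block_encoded cong: conj_cong)
  then show "(\<exists>B\<in>encoded n f L. p \<in> B \<and> q \<in> B) \<longleftrightarrow> (\<exists>B\<in>encoded n g M. p \<in> B \<and> q \<in> B)"
    by (simp only: same_block_def)
qed

lemma encoded_eqD:
  assumes "encoded n f L = encoded n g M"
    and f: "f ` {1..n} \<subseteq> {1..n}"
  shows "i \<in> {1..n} \<Longrightarrow> j \<in> {1..n} \<Longrightarrow> eqv L i j \<longleftrightarrow> eqv M i j"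
    and "i \<in> {1..n} \<Longrightarrow> eqv M (f i) (g i)"
proof -
  have eq: "eqv L (lower_point f p) (lower_point f q) \<longleftrightarrow> eqv M (lower_point g p) (lower_point g q)"
    if "p \<in> points n" "q \<in> points n" for p q
  proof -
    have "same_block (encoded n f L) p q \<longleftrightarrow> same_block (encoded n g M) p q"
      by (simp only: assms(1))
    with that show ?thesis
      unfolding same_block_encoded by blast
  qed
  show "i \<in> {1..n} \<Longrightarrow> j \<in> {1..n} \<Longrightarrow> eqv L i j \<longleftrightarrow> eqv M i j"
    using eq[of "Bot i" "Bot j"] by (auto simp: points_def)
  show "i \<in> {1..n} \<Longrightarrow> eqv M (f i) (g i)"
    using eq[of "Bot (f i)" "Top i"] f by (auto simp: points_def image_subset_iff)
qed

text \<open>Full domain supplies a lower point in the block of each upper point; choosing one gives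
  f, and L is the whole equivalence on the lower row.\<close>

lemma exists_encoded:
  assumes "a \<in> carrier (full_domain_partition_monoid n)"
  obtains f L where "f ` {1..n} \<subseteq> {1..n}" "L \<subseteq> {1..n} \<times> {1..n}" "a = encoded n f L"
    "\<forall>x. x \<notin> {1..n} \<longrightarrow> f x = x"
proof -
  have a: "partition_on (points n) a"
    and dom0: "\<forall>x\<in>{1..n}. \<exists>B\<in>a. Top x \<in> B \<and> (\<exists>y\<in>{1..n}. Bot y \<in> B)"
    using assms by (simp_all add: full_domain_partition_monoid_def partition_monoid_def)
  have dom: "\<exists>y\<in>{1..n}. same_block a (Top x) (Bot y)" if "x \<in> {1..n}" for x
    using dom0[rule_format, OF that] unfolding same_block_def by blast
  have sym: "same_block a p q \<Longrightarrow> same_block a q p" for p q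
    by (auto simp: same_block_def)
  have trans: "same_block a p q \<Longrightarrow> same_block a q r \<Longrightarrow> same_block a p r" for p q r
    using partition_onD2[OF a] unfolding same_block_def disjoint_def
    by (metis IntI emptyE)
  have refl: "same_block a p p" if "p \<in> points n" for p
    using that partition_onD1[OF a] unfolding same_block_def by blast
  have pts: "p \<in> points n \<and> q \<in> points n" if "same_block a p q" for p q
    using that partition_onD1[OF a] unfolding same_block_def by blast
  obtain f0 where f0: "\<And>x. x \<in> {1..n} \<Longrightarrow> f0 x \<in> {1..n} \<and> same_block a (Top x) (Bot (f0 x))"
    using dom by metis
  \<comment> \<open>Fixing the points outside {1..n} matches \<open>act\<close>, which does so for
    every word over the alphabet; hence f can later be realised exactly by a word.\<close>
  define f where "f x = (if x \<in> {1..n} then f0 x else x)" for x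
  have f: "f x \<in> {1..n}" "same_block a (Top x) (Bot (f x))" if "x \<in> {1..n}" for x
    using f0 that by (auto simp: f_def)
  define L where "L = {(i, j). i \<in> {1..n} \<and> j \<in> {1..n} \<and> same_block a (Bot i) (Bot j)}"
  have eqvL: "i = j \<or> same_block a (Bot i) (Bot j)" if "eqv L i j" for i j
    using that by (rule eqv_least) (auto simp: L_def intro: sym trans)
  have low: "same_block a p (Bot (lower_point f p)) \<and> lower_point f p \<in> {1..n}"
    if "p \<in> points n" for p
    using that f by (auto simp: points_def intro!: refl)
  have "same_block a p q \<longleftrightarrow> same_block (encoded n f L) p q" for p q
  proof
    assume "same_block a p q"
    with low pts have "same_block a (Bot (lower_point f p)) (Bot (lower_point f q))"
      "p \<in> points n" "q \<in> points n"
      by (blast intro: sym trans)+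
    with low show "same_block (encoded n f L) p q"
      unfolding same_block_encoded by (auto intro!: eqv_base simp: L_def)
  next
    assume "same_block (encoded n f L) p q"
    then have *: "p \<in> points n" "q \<in> points n" "eqv L (lower_point f p) (lower_point f q)"
      unfolding same_block_encoded by auto
    from eqvL[OF *(3)] low[OF *(1)] low[OF *(2)] show "same_block a p q"
      by (metis sym trans)
  qed
  then have "a = encoded n f L"
    by (intro partition_on_eqI[OF a encoded_partition_on]) (simp only: same_block_def)
  moreover have "f ` {1..n} \<subseteq> {1..n}"
    using f(1) by blast
  ultimately show thesis
    by (intro that[of f L]) (auto simp: L_def f_def)
qed

lemma encoded_in_carrier:
  assumes "f ` {1..n} \<subseteq> {1..n}"
  shows "encoded n f L \<in> carrier (full_domain_partition_monoid n)"
proof -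
  have "\<exists>B\<in>encoded n f L. Top x \<in> B \<and> (\<exists>y\<in>{1..n}. Bot y \<in> B)" if x: "x \<in> {1..n}" for x
  proof -
    have fx: "f x \<in> {1..n}"
      using assms x by blast
    then have "same_block (encoded n f L) (Top x) (Bot (f x))"
      using x by (simp add: same_block_encoded points_def)
    with fx show ?thesis
      unfolding same_block_def by blast
  qed
  then show ?thesis
    using encoded_partition_on by (simp add: full_domain_partition_monoid_def partition_monoid_def)
qed

section \<open>Products of encoded elements\<close>

lemma connected_in_product_same_block:
  "connected_in_product a b =
    equivclp (\<lambda>x y. (\<exists>p q. same_block a p q \<and> x = bot_to_mid p \<and> y = bot_to_mid q) \<or>
                    (\<exists>p q. same_block b p q \<and> x = top_to_mid p \<and> y = top_to_mid q))"
proof -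
  have "(\<exists>B\<in>down a \<union> up b. x \<in> B \<and> y \<in> B) \<longleftrightarrow>
      (\<exists>B\<in>a. x \<in> bot_to_mid ` B \<and> y \<in> bot_to_mid ` B) \<or>
      (\<exists>B\<in>b. x \<in> top_to_mid ` B \<and> y \<in> top_to_mid ` B)" for x y
    by (simp add: down_def up_def bex_Un)
  also have "\<dots> x y \<longleftrightarrow>
      (\<exists>p q. same_block a p q \<and> x = bot_to_mid p \<and> y = bot_to_mid q) \<or>
      (\<exists>p q. same_block b p q \<and> x = top_to_mid p \<and> y = top_to_mid q)" for x y
    unfolding same_block_def image_iff by blast
  finally show ?thesis
    unfolding connected_in_product_def by presburger
qed

text \<open>In the product diagram the middle point i'' is joined to the lower point (g i)', so
  every point can be pushed down to the bottom row. There the second factor contributes M, and the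
  equivalence L of the middle row arrives through g.\<close>

lemma connected_in_product_encoded:
  assumes f: "f ` {1..n} \<subseteq> {1..n}" and g: "g ` {1..n} \<subseteq> {1..n}"
    and L: "L \<subseteq> {1..n} \<times> {1..n}" and M: "M \<subseteq> {1..n} \<times> {1..n}"
    and p: "p \<in> points n" and q: "q \<in> points n"
  shows "connected_in_product (encoded n f L) (encoded n g M) p q \<longleftrightarrow>
    eqv (M \<union> map_prod g g ` L) (lower_point (g \<circ> f) p) (lower_point (g \<circ> f) q)"
proof
  let ?N = "M \<union> map_prod g g ` L"
  let ?c = "connected_in_product (encoded n f L) (encoded n g M)"
  \<comment> \<open>The bottom point to which a point of each row is pushed; the edges coming from
    either factor respect it modulo \<open>?N\<close>.\<close>
  define low where "low r = (case r of Top x \<Rightarrow> g (f x) | Mid x \<Rightarrow> g x | Bot x \<Rightarrow> x)" for r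
  have low1: "low (bot_to_mid r) = g (lower_point f r)" if "r \<in> points n" for r
    using that by (auto simp: points_def low_def)
  have low2: "low (top_to_mid r) = lower_point g r" if "r \<in> points n" for r
    using that by (auto simp: points_def low_def)
  have low3: "low r = lower_point (g \<circ> f) r" if "r \<in> points n" for r
    using that by (auto simp: points_def low_def)
  have gL: "eqv ?N (g i) (g j)" if "eqv L i j" for i j
    using that by (rule eqv_map) (force intro: eqv_base)
  have MN: "eqv ?N i j" if "eqv M i j" for i j
    using that by (rule eqv_mono) (auto intro: eqv_base)
  define R where "R = {(x, y).
    (\<exists>p q. same_block (encoded n f L) p q \<and> x = bot_to_mid p \<and> y = bot_to_mid q) \<or>
    (\<exists>p q. same_block (encoded n g M) p q \<and> x = top_to_mid p \<and> y = top_to_mid q)}"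
  have c_eqv: "?c = eqv R"
    by (simp add: connected_in_product_same_block eqv_def R_def)
  have step: "eqv ?N (low x) (low y)" if "(x, y) \<in> R" for x y
    using that by (auto simp: R_def same_block_encoded low1 low2 gL MN)
  {
    assume "?c p q"
    then have "eqv ?N (low p) (low q)"
      unfolding c_eqv using step by (rule eqv_map)
    then show "eqv ?N (lower_point (g \<circ> f) p) (lower_point (g \<circ> f) q)"
      using low3 p q by simp
  }
  have c_sym: "?c x y \<Longrightarrow> ?c y x" and c_trans: "?c x y \<Longrightarrow> ?c y z \<Longrightarrow> ?c x z"
    and c_refl: "?c x x" for x y z
    unfolding c_eqv by (fact eqv_sym eqv_trans eqv_refl)+
  have c1: "?c (bot_to_mid p) (bot_to_mid q)" if "same_block (encoded n f L) p q" for p q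
    using that unfolding c_eqv by (intro eqv_base) (auto simp: R_def)
  have c2: "?c (top_to_mid p) (top_to_mid q)" if "same_block (encoded n g M) p q" for p q
    using that unfolding c_eqv by (intro eqv_base) (auto simp: R_def)
  have mid_bot: "?c (Mid i) (Bot (g i))" if "i \<in> {1..n}" for i
    using c2[of "Top i" "Bot (g i)"] that g by (auto simp: same_block_encoded points_def image_subset_iff)
  have top_mid: "?c (Top i) (Mid (f i))" if "i \<in> {1..n}" for i
    using c1[of "Top i" "Bot (f i)"] that f by (auto simp: same_block_encoded points_def image_subset_iff)
  have to_bot: "?c r (Bot (lower_point (g \<circ> f) r))" if "r \<in> points n" for r
  proof (cases r)
    case (Top x)
    with that have "x \<in> {1..n}"
      by (auto simp: points_def)
    moreover from this f have "f x \<in> {1..n}"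
      by blast
    ultimately show ?thesis
      using c_trans[OF top_mid mid_bot] Top by simp
  qed (use that c_refl in \<open>auto simp: points_def\<close>)
  have NC: "?c (Bot i) (Bot j)" if "(i, j) \<in> ?N" for i j
    using that
  proof
    assume ij: "(i, j) \<in> M"
    then show ?thesis
      using c2[of "Bot i" "Bot j"] M by (auto simp: same_block_encoded points_def intro: eqv_base)
  next
    assume "(i, j) \<in> map_prod g g ` L"
    then obtain k l where kl: "(k, l) \<in> L" "i = g k" "j = g l" by auto
    then have "?c (Mid k) (Mid l)"
      using c1[of "Bot k" "Bot l"] L by (auto simp: same_block_encoded points_def intro: eqv_base)
    with kl L mid_bot show ?thesis
      by (metis c_sym c_trans mem_Sigma_iff subsetD)
  qed
  {
    assume "eqv ?N (lower_point (g \<circ> f) p) (lower_point (g \<circ> f) q)"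
    then have "?c (Bot (lower_point (g \<circ> f) p)) (Bot (lower_point (g \<circ> f) q))"
      by (rule eqv_least) (auto intro: NC c_refl c_sym c_trans)
    then show "?c p q"
      using to_bot[OF p] to_bot[OF q] by (meson c_sym c_trans)
  }
qed

lemma partition_mult_encoded:
  assumes "f ` {1..n} \<subseteq> {1..n}" "g ` {1..n} \<subseteq> {1..n}"
    and "L \<subseteq> {1..n} \<times> {1..n}" "M \<subseteq> {1..n} \<times> {1..n}"
  shows "encoded n f L \<otimes>\<^bsub>full_domain_partition_monoid n\<^esub> encoded n g M =
    encoded n (g \<circ> f) (M \<union> map_prod g g ` L)"
proof -
  have "partition_mult n (encoded n f L) (encoded n g M) =
      encoded n (g \<circ> f) (M \<union> map_prod g g ` L)"
    unfolding partition_mult_def encoded_def[of n "g \<circ> f"]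
    by (intro image_cong Collect_cong conj_cong connected_in_product_encoded[OF assms]) simp_all
  then show ?thesis
    by (simp add: full_domain_partition_monoid_def partition_monoid_def)
qed

lemma eqv_empty [simp]: "eqv {} i j \<longleftrightarrow> i = j"
proof
  show "i = j" if "eqv {} i j"
    using that by (rule eqv_least) auto
qed simp

text \<open>Since f takes values in {1..n}, every block contains a lower point j. Indexing the
  blocks by j gives a list that can be compared with the generators.\<close>

lemma encoded_as_image:
  assumes f: "f ` {1..n} \<subseteq> {1..n}"
  shows "encoded n f L =
    (\<lambda>j. Top ` {x \<in> {1..n}. eqv L j (f x)} \<union> Bot ` {k \<in> {1..n}. eqv L j k}) ` {1..n}"
proof -
  have img: "lower_point f ` points n = {1..n}"
    using f by (auto simp: points_def image_Un image_image)
  have "encoded n f L = (\<lambda>j. {q \<in> points n. eqv L j (lower_point f q)}) ` lower_point f ` points n"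
    by (simp add: encoded_def image_image)
  also have "\<dots> = (\<lambda>j. Top ` {x \<in> {1..n}. eqv L j (f x)} \<union> Bot ` {k \<in> {1..n}. eqv L j k}) ` {1..n}"
    unfolding img by (rule image_cong) (auto simp: points_def)
  finally show ?thesis .
qed

lemma partition_one_encoded: "\<one>\<^bsub>full_domain_partition_monoid n\<^esub> = encoded n id {}"
proof -
  have "encoded n id {} = (\<lambda>x. {Top x, Bot x}) ` {1..n}"
    unfolding encoded_as_image[of id n "{}", simplified] by (rule image_cong) auto
  then show ?thesis
    by (simp add: full_domain_partition_monoid_def partition_monoid_def partition_one_def)
qed

text \<open>In terms of codes, associativity is that of composition and of unions of transported
  relations; no diagram with four rows has to be considered.\<close>

lemma full_domain_partition_monoid_is_monoid: "monoid (full_domain_partition_monoid n)"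
proof (rule monoidI)
  fix x y z
  assume xc: "x \<in> carrier (full_domain_partition_monoid n)"
    and yc: "y \<in> carrier (full_domain_partition_monoid n)"
    and zc: "z \<in> carrier (full_domain_partition_monoid n)"
  obtain f L where x: "f ` {1..n} \<subseteq> {1..n}" "L \<subseteq> {1..n} \<times> {1..n}"
      "x = encoded n f L"
    by (rule exists_encoded[OF xc])
  obtain g M where y: "g ` {1..n} \<subseteq> {1..n}" "M \<subseteq> {1..n} \<times> {1..n}"
      "y = encoded n g M"
    by (rule exists_encoded[OF yc])
  obtain h N where z: "h ` {1..n} \<subseteq> {1..n}" "N \<subseteq> {1..n} \<times> {1..n}"
      "z = encoded n h N"
    by (rule exists_encoded[OF zc])
  have gf: "(g \<circ> f) ` {1..n} \<subseteq> {1..n}" and hg: "(h \<circ> g) ` {1..n} \<subseteq> {1..n}"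
    using x y z by (auto simp: image_subset_iff)
  have img: "map_prod k k ` K \<subseteq> {1..n} \<times> {1..n}"
    if "k ` {1..n} \<subseteq> {1..n}" "K \<subseteq> {1..n} \<times> {1..n}" for k K
    using that by fastforce
  show "x \<otimes>\<^bsub>full_domain_partition_monoid n\<^esub> y \<in> carrier (full_domain_partition_monoid n)"
    using x y gf by (simp add: partition_mult_encoded encoded_in_carrier)
  show "x \<otimes>\<^bsub>full_domain_partition_monoid n\<^esub> y \<otimes>\<^bsub>full_domain_partition_monoid n\<^esub> z =
      x \<otimes>\<^bsub>full_domain_partition_monoid n\<^esub> (y \<otimes>\<^bsub>full_domain_partition_monoid n\<^esub> z)"
    using x y z gf hg img
    by (simp add: partition_mult_encoded image_Un image_image comp_assoc Un_assoc prod.map_comp)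
next
  show "\<one>\<^bsub>full_domain_partition_monoid n\<^esub> \<in> carrier (full_domain_partition_monoid n)"
    by (simp add: partition_one_encoded encoded_in_carrier)
next
  fix x assume xc: "x \<in> carrier (full_domain_partition_monoid n)"
  obtain f L where x: "f ` {1..n} \<subseteq> {1..n}" "L \<subseteq> {1..n} \<times> {1..n}"
      "x = encoded n f L"
    by (rule exists_encoded[OF xc])
  show "\<one>\<^bsub>full_domain_partition_monoid n\<^esub> \<otimes>\<^bsub>full_domain_partition_monoid n\<^esub> x = x"
    using x by (simp add: partition_one_encoded partition_mult_encoded)
  show "x \<otimes>\<^bsub>full_domain_partition_monoid n\<^esub> \<one>\<^bsub>full_domain_partition_monoid n\<^esub> = x"
    using x by (simp add: partition_one_encoded partition_mult_encoded map_prod.id)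
qed

section \<open>Codes of words\<close>

fun letter_map :: "letter \<Rightarrow> nat \<Rightarrow> nat" where
  "letter_map (S i) = transpose i (i + 1)"
| "letter_map T = id(2 := 1)"
| "letter_map E = id"

fun act :: "letter list \<Rightarrow> nat \<Rightarrow> nat" where
  "act [] = id"
| "act (c # u) = act u \<circ> letter_map c"

text \<open>The pair (1, 2) merged by an \<open>E\<close> is carried to the bottom row by the
  letters after it, hence \<open>act\<close> of the remaining word. \<open>letter_map\<close> is the
  identity on \<open>E\<close>, so the merging is recorded here alone.\<close>

fun pairs :: "letter list \<Rightarrow> (nat \<times> nat) list" where
  "pairs [] = []"
| "pairs (c # u) = (if c = E then [(act u 1, act u 2)] else []) @ pairs u"

lemma act_append: "act (u @ v) = act v \<circ> act u"
  by (induction u) (simp_all add: comp_assoc)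

lemma pairs_append: "pairs (u @ v) = map (map_prod (act v) (act v)) (pairs u) @ pairs v"
  by (induction u) (simp_all add: act_append)

lemma letter_map_in: "2 \<le> n \<Longrightarrow> c \<in> alphabet n \<Longrightarrow> letter_map c ` {1..n} \<subseteq> {1..n}"
  by (auto simp: alphabet_def transpose_def split: if_splits)

lemma act_in: "2 \<le> n \<Longrightarrow> u \<in> lists (alphabet n) \<Longrightarrow> act u ` {1..n} \<subseteq> {1..n}"
proof (induction u)
  case (Cons c u)
  then have "act u ` letter_map c ` {1..n} \<subseteq> act u ` {1..n}"
    by (intro image_mono letter_map_in) auto
  with Cons show ?case
    by (auto simp: image_comp)
qed simp

lemma pairs_in: "2 \<le> n \<Longrightarrow> u \<in> lists (alphabet n) \<Longrightarrow> set (pairs u) \<subseteq> {1..n} \<times> {1..n}"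
proof (induction u)
  case (Cons c u)
  then have "act u ` {1..n} \<subseteq> {1..n}"
    by (intro act_in) auto
  then have "act u 1 \<in> {1..n}" "act u 2 \<in> {1..n}"
    using Cons.prems(1) by (auto simp: image_subset_iff)
  with Cons show ?case
    by auto
qed simp

text \<open>Isolates the lower points 1 and 2, the only ones whose blocks in \<open>T\<close> and
  \<open>E\<close> differ from those of the identity.\<close>

lemma encoded_split:
  assumes n: "2 \<le> n" and f: "f ` {1..n} \<subseteq> {1..n}"
  shows "encoded n f L =
    insert (Top ` {x \<in> {1..n}. eqv L 1 (f x)} \<union> Bot ` {k \<in> {1..n}. eqv L 1 k})
      (insert (Top ` {x \<in> {1..n}. eqv L 2 (f x)} \<union> Bot ` {k \<in> {1..n}. eqv L 2 k})
        ((\<lambda>j. Top ` {x \<in> {1..n}. eqv L j (f x)} \<union> Bot ` {k \<in> {1..n}. eqv L j k}) ` {3..n}))"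
proof -
  define K where "K j = Top ` {x \<in> {1..n}. eqv L j (f x)} \<union> Bot ` {k \<in> {1..n}. eqv L j k}" for j
  have "encoded n f L = K ` {1..n}"
    unfolding encoded_as_image[OF f] K_def ..
  also have "{1..n} = insert 1 (insert 2 {3..n})"
    using n by auto
  also have "K ` \<dots> = insert (K 1) (insert (K 2) (K ` {3..n}))"
    by (simp only: image_insert)
  finally show ?thesis
    unfolding K_def .
qed

lemma generator_encoded:
  assumes n: "2 \<le> n" and c: "c \<in> alphabet n"
  shows "generator n c = encoded n (letter_map c) (if c = E then {(1, 2)} else {})"
proof (cases c)
  case (S i)
  with c have i: "1 \<le> i" "i < n"
    by (auto simp: alphabet_def)
  \<comment> \<open>The upper point in the block of the lower point j is the preimage of j, and a
    transposition is its own inverse.\<close>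
  have "encoded n (letter_map c) {} = (\<lambda>j. {Top (transpose i (i + 1) j), Bot j}) ` {1..n}"
    unfolding encoded_as_image[OF letter_map_in[OF n c]] using i S
    by (intro image_cong) (auto simp: transpose_def)
  also have "{1..n} = insert i (insert (i + 1) ({1..n} - {i, i + 1}))"
    using i by auto
  also have "(\<lambda>j. {Top (transpose i (i + 1) j), Bot j}) ` \<dots> =
      insert {Top (i + 1), Bot i} (insert {Top i, Bot (i + 1)}
        ((\<lambda>j. {Top j, Bot j}) ` ({1..n} - {i, i + 1})))"
    unfolding image_insert by (intro arg_cong2[where f = insert] image_cong) auto
  also have "\<dots> = generator n c"
    using S by auto
  finally show ?thesis
    using S by simp
next
  case E
  define L :: "nat rel" where "L = {(1, 2)}"
  have L12: "eqv L 1 2" "eqv L 2 1"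
    by (auto simp: L_def intro: eqv_base eqv_sym)
  have eqvL: "i = j \<or> i \<in> {1, 2} \<and> j \<in> {1, 2}" if "eqv L i j" for i j
    using that by (rule eqv_least) (auto simp: L_def)
  have eqvL_iff: "eqv L i j \<longleftrightarrow> i = j \<or> i \<in> {1, 2} \<and> j \<in> {1, 2}" for i j
  proof
    show "eqv L i j" if "i = j \<or> i \<in> {1, 2} \<and> j \<in> {1, 2}"
      using that L12 by (elim disjE) (simp, blast intro: eqv_refl)
  qed (fact eqvL)
  have "{x \<in> {1..n}. eqv L 1 x} = {1, 2}" "{x \<in> {1..n}. eqv L 2 x} = {1, 2}"
    and "\<And>j. j \<in> {3..n} \<Longrightarrow> {x \<in> {1..n}. eqv L j x} = {j}"
    using n by (auto simp: eqvL_iff)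
  then have "encoded n (letter_map c) L = insert {Top 1, Top 2, Bot 1, Bot 2}
      (insert {Top 1, Top 2, Bot 1, Bot 2} ((\<lambda>x. {Top x, Bot x}) ` {3..n}))"
    unfolding encoded_split[OF n letter_map_in[OF n c]] using E
    by (simp add: insert_commute)
  with E show ?thesis
    by (simp add: L_def)
next
  case T
  have 1: "Top ` {x \<in> {1..n}. 1 = letter_map T x} \<union> Bot ` {k \<in> {1..n}. 1 = k} = {Top 1, Top 2, Bot 1}"
    using n by (auto split: if_splits)
  have 2: "Top ` {x \<in> {1..n}. 2 = letter_map T x} \<union> Bot ` {k \<in> {1..n}. 2 = k} = {Bot 2}"
    using n by (auto split: if_splits)
  have 3: "(\<lambda>j. Top ` {x \<in> {1..n}. j = letter_map T x} \<union> Bot ` {k \<in> {1..n}. j = k}) ` {3..n} =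
      (\<lambda>x. {Top x, Bot x}) ` {3..n}"
    by (rule image_cong) (auto split: if_splits)
  have "encoded n (letter_map T) {} = generator n T"
    unfolding encoded_split[OF n letter_map_in[OF n c[unfolded T]]] eqv_empty 1 2 3 by auto
  with T show ?thesis
    by simp
qed

lemma presentation_map_encoded:
  assumes n: "2 \<le> n" and "u \<in> lists (alphabet n)"
  shows "presentation_map n u = encoded n (act u) (set (pairs u))"
  using assms(2)
proof (induction u)
  case Nil
  then show ?case
    by (simp add: presentation_map_def word_morphism_def partition_one_encoded id_def)
next
  case (Cons c u)
  have "presentation_map n (c # u) =
      generator n c \<otimes>\<^bsub>full_domain_partition_monoid n\<^esub> presentation_map n u"
    by (simp add: presentation_map_def word_morphism_def)
  also have "\<dots> = encoded n (letter_map c) (if c = E then {(1, 2)} else {})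
      \<otimes>\<^bsub>full_domain_partition_monoid n\<^esub> encoded n (act u) (set (pairs u))"
    using Cons n by (simp add: generator_encoded)
  also have "\<dots> = encoded n (act (c # u)) (set (pairs (c # u)))"
    using Cons n pairs_in[OF n, of u] letter_map_in[OF n, of c] act_in[OF n, of u]
    by (subst partition_mult_encoded) auto
  finally show ?case .
qed

section \<open>Soundness of the relations\<close>

lemma eqv_cong:
  assumes "\<And>x y. (x, y) \<in> L \<Longrightarrow> eqv M x y" "\<And>x y. (x, y) \<in> M \<Longrightarrow> eqv L x y"
  shows "eqv L = eqv M"
  using eqv_mono[of L _ _ M] eqv_mono[of M _ _ L] assms by (intro ext) blast

text \<open>Agreement is required on all of \<open>nat\<close>, so that no range conditions arise
  when it is propagated through the congruence. For words over the alphabet it implies equality of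
  the encoded partitions.\<close>

definition equal_codes :: "letter list \<Rightarrow> letter list \<Rightarrow> bool" where
  "equal_codes u v \<longleftrightarrow> eqv (set (pairs u)) = eqv (set (pairs v)) \<and>
    (\<forall>x. eqv (set (pairs v)) (act u x) (act v x))"

lemma equal_codesI: "set (pairs u) = set (pairs v) \<Longrightarrow> act u = act v \<Longrightarrow> equal_codes u v"
  by (simp add: equal_codes_def)

lemma act_word_w:
  "act word_w = (\<lambda>x. if x = 1 then 3 else if x = 2 then 4 else if x = 3 then 1 else if x = 4 then 2 else x)"
proof
  fix x :: nat
  consider "x = 1" | "x = 2" | "x = 3" | "x = 4" | "x \<notin> {1, 2, 3, 4}"
    by blast
  then show "act word_w x =
      (if x = 1 then 3 else if x = 2 then 4 else if x = 3 then 1 else if x = 4 then 2 else x)"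
    by cases (simp_all add: word_w_def transpose_def)
qed

lemma pairs_word_w [simp]: "pairs word_w = []"
  by (simp add: word_w_def)

lemma equal_codes_relations:
  assumes "(u, v) \<in> relations n"
  shows "equal_codes u v"
proof -
  have eqv12: "eqv {(1::nat, 2)} 1 2" "eqv {(1::nat, 2)} 2 1"
    by (auto intro: eqv_base eqv_sym)
  have eqv21: "eqv {(2::nat, 1)} = eqv {(1, 2)}"
    by (rule eqv_cong) (auto intro: eqv_base eqv_sym)
  \<comment> \<open>Needed for et = t: the letter t sends both 1 and 2 to 1, so the pair recorded
    for the letter e becomes (1, 1), which generates only equality.\<close>
  have eqv11: "eqv {(1, 1)} = eqv ({} :: nat rel)"
    by (rule eqv_cong) auto
  have "equal_codes [S i, S i] []" for i
    by (auto simp: equal_codes_def)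
  moreover have "equal_codes [S i, S j] [S j, S i]" if "\<bar>int i - int j\<bar> > 1" for i j
    using that by (auto intro!: equal_codesI simp: fun_eq_iff transpose_def)
  moreover have "equal_codes [S i, S j, S i] [S j, S i, S j]" if "\<bar>int i - int j\<bar> = 1" for i j
  proof -
    have "j = i + 1 \<or> i = j + 1"
      using that by linarith
    then show ?thesis
      by (auto intro!: equal_codesI simp: fun_eq_iff transpose_def)
  qed
  moreover have "equal_codes [T, T] [T]"
    by (auto simp: equal_codes_def)
  moreover have "equal_codes [T] [E, T]"
    using eqv11 by (simp add: equal_codes_def)
  moreover have "equal_codes [E, T] [S 1, T]"
    using eqv11 by (simp add: equal_codes_def transpose_def)
  moreover have "equal_codes [E, E] [E]"
    by (simp add: equal_codes_def)
  moreover have "equal_codes [E] [T, E]" "equal_codes [T, E] [S 1, E]" "equal_codes [S 1, E] [E, S 1]"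
    using eqv12 eqv21 by (simp_all add: equal_codes_def transpose_def numeral_2_eq_2)
  moreover have "equal_codes [S i, T] [T, S i]" "equal_codes [S i, E] [E, S i]" if "i > 2" for i
    using that by (auto intro!: equal_codesI simp: fun_eq_iff transpose_def)
  moreover have "equal_codes [T, S 1, S 2, T] [T, S 1, S 2, S 1]"
    "equal_codes [T, S 2, T, S 2] [S 2, T, S 2, T]"
    by (auto intro!: equal_codesI simp: fun_eq_iff transpose_def)
  moreover have "equal_codes [E, S 2, E, S 2] [S 2, E, S 2, E]"
    "equal_codes [T, S 2, E, S 2] [S 2, E, S 2, T]"
    by (auto intro!: equal_codesI simp: fun_eq_iff transpose_def insert_commute)
  moreover have "equal_codes ([T] @ word_w @ [T] @ word_w) (word_w @ [T] @ word_w @ [T])"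
    by (rule equal_codesI) (auto simp: fun_eq_iff pairs_append act_append act_word_w)
  moreover have "equal_codes ([E] @ word_w @ [E] @ word_w) (word_w @ [E] @ word_w @ [E])"
    by (rule equal_codesI) (auto simp: fun_eq_iff pairs_append act_append act_word_w)
  moreover have "equal_codes ([T] @ word_w @ [E] @ word_w) (word_w @ [E] @ word_w @ [T])"
    by (rule equal_codesI) (auto simp: fun_eq_iff pairs_append act_append act_word_w)
  ultimately show ?thesis
    using assms unfolding relations_def by blast
qed

lemma equal_codes_sym: "equal_codes u v \<Longrightarrow> equal_codes v u"
  by (simp add: equal_codes_def eqv_sym)

lemma equal_codes_trans: "equal_codes u v \<Longrightarrow> equal_codes v w \<Longrightarrow> equal_codes u w"
  unfolding equal_codes_def by (metis eqv_trans)

text \<open>Since \<open>act u'\<close> and \<open>act v'\<close> agree only modulo the pairs of v',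
  two moves have to be combined, which \<open>app\<close> does: an equivalence is transported along
  \<open>act v'\<close>, and the change from \<open>act u'\<close> to \<open>act v'\<close> is
  absorbed by the pairs of v'.\<close>

lemma equal_codes_append:
  assumes "equal_codes u v" "equal_codes u' v'"
  shows "equal_codes (u @ u') (v @ v')"
proof -
  have map: "eqv (set (pairs (v @ v'))) (act v' i) (act v' j)" if "eqv (set (pairs v)) i j" for v v' i j
    using that by (rule eqv_map) (force simp: pairs_append intro: eqv_base)
  have mono: "eqv (set (pairs (v @ v'))) i j" if "eqv (set (pairs v')) i j" for v v' i j
    using that by (rule eqv_mono) (auto simp: pairs_append intro: eqv_base)
  have app: "eqv (set (pairs (v @ v'))) (act u' i) (act v' j)"
    if "equal_codes u' v'" "eqv (set (pairs v)) i j" for u' v v' i j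
    using that map mono unfolding equal_codes_def by (blast intro: eqv_trans)
  have sub: "eqv (set (pairs (v @ v'))) x y"
    if uv: "equal_codes u v" "equal_codes u' v'" and xy: "(x, y) \<in> set (pairs (u @ u'))" for u v u' v' x y
  proof -
    from xy consider i j where "(i, j) \<in> set (pairs u)" "x = act u' i" "y = act u' j"
      | "(x, y) \<in> set (pairs u')"
      by (auto simp: pairs_append)
    then show ?thesis
    proof cases
      case 1
      with uv have "eqv (set (pairs v)) i j"
        unfolding equal_codes_def by (metis eqv_base)
      then have "eqv (set (pairs (v @ v'))) (act u' i) (act v' j)"
        by (rule app[OF uv(2)])
      moreover have "eqv (set (pairs (v @ v'))) (act u' j) (act v' j)"
        by (rule app[OF uv(2) eqv_refl])
      ultimately show ?thesis
        unfolding 1(2,3) by (rule eqv_trans[OF _ eqv_sym])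
    next
      case 2
      with uv show ?thesis
        unfolding equal_codes_def by (metis eqv_base mono)
    qed
  qed
  have "eqv (set (pairs (u @ u'))) = eqv (set (pairs (v @ v')))"
    using assms equal_codes_sym[OF assms(1)] equal_codes_sym[OF assms(2)]
    by (intro eqv_cong sub)
  moreover have "eqv (set (pairs (v @ v'))) (act (u @ u') x) (act (v @ v') x)" for x
    using app[OF assms(2), of v] assms(1) by (simp add: act_append equal_codes_def)
  ultimately show ?thesis
    by (simp add: equal_codes_def)
qed

lemma equal_codes_generated_congruence:
  assumes "(u, v) \<in> generated_congruence (free_monoid (alphabet n)) (relations n)"
  shows "equal_codes u v \<and> u \<in> lists (alphabet n) \<and> v \<in> lists (alphabet n)"
  using assms
proof induction
  case (base u v)
  then show ?case
    using equal_codes_relations[OF base] by (auto simp: relations_def)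
next
  case (mult u v u' v')
  then show ?case
    by (auto simp: free_monoid_def intro: equal_codes_append)
next
  case (refl u)
  then show ?case
    by (simp add: equal_codes_def free_monoid_def)
qed (auto intro: equal_codes_sym equal_codes_trans)

text \<open>Reduces the kernel of \<open>presentation_map\<close> to a condition on
  \<open>act\<close> and \<open>pairs\<close>, so that neither soundness nor completeness has to
  argue with partitions.\<close>

lemma presentation_map_eq_iff:
  assumes n: "2 \<le> n" and u: "u \<in> lists (alphabet n)" and v: "v \<in> lists (alphabet n)"
  shows "presentation_map n u = presentation_map n v \<longleftrightarrow>
    (\<forall>i\<in>{1..n}. \<forall>j\<in>{1..n}. eqv (set (pairs u)) i j \<longleftrightarrow> eqv (set (pairs v)) i j) \<and>
    (\<forall>i\<in>{1..n}. eqv (set (pairs v)) (act u i) (act v i))"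
  unfolding presentation_map_encoded[OF n u] presentation_map_encoded[OF n v]
proof
  assume "encoded n (act u) (set (pairs u)) = encoded n (act v) (set (pairs v))"
  from encoded_eqD[OF this act_in[OF n u]]
  show "(\<forall>i\<in>{1..n}. \<forall>j\<in>{1..n}. eqv (set (pairs u)) i j \<longleftrightarrow> eqv (set (pairs v)) i j) \<and>
      (\<forall>i\<in>{1..n}. eqv (set (pairs v)) (act u i) (act v i))"
    by (intro conjI ballI)
next
  assume "(\<forall>i\<in>{1..n}. \<forall>j\<in>{1..n}. eqv (set (pairs u)) i j \<longleftrightarrow> eqv (set (pairs v)) i j) \<and>
      (\<forall>i\<in>{1..n}. eqv (set (pairs v)) (act u i) (act v i))"
  then have eq: "\<And>i j. i \<in> {1..n} \<Longrightarrow> j \<in> {1..n} \<Longrightarrow> eqv (set (pairs u)) i j \<longleftrightarrow> eqv (set (pairs v)) i j"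
    and act: "\<And>i. i \<in> {1..n} \<Longrightarrow> eqv (set (pairs v)) (act u i) (act v i)"
    by simp_all
  show "encoded n (act u) (set (pairs u)) = encoded n (act v) (set (pairs v))"
    by (rule encoded_eqI[OF eq]) (use act act_in[OF n u] act_in[OF n v] in blast)+
qed

section \<open>Consequences of the relations\<close>

text \<open>A and its image have equally large complements in B, and any bijection between these
  completes f.\<close>

lemma extend_to_permutation:
  assumes "finite B" "A \<subseteq> B" "inj_on f A" "f ` A \<subseteq> B"
  obtains p where "p permutes B" "\<And>x. x \<in> A \<Longrightarrow> p x = f x"
proof -
  have "card (B - A) = card (B - f ` A)"
    using assms by (simp add: card_Diff_subset finite_subset card_image)
  then obtain h where h: "bij_betw h (B - A) (B - f ` A)"
    using assms(1) finite_same_card_bij[of "B - A" "B - f ` A"] by auto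
  define p where "p x = (if x \<in> A then f x else if x \<in> B then h x else x)" for x
  have "bij_betw p A (f ` A)"
    using inj_on_imp_bij_betw[OF assms(3)] by (subst bij_betw_cong[of A p f]) (simp_all add: p_def)
  moreover have "bij_betw p (B - A) (B - f ` A)"
    using h by (subst bij_betw_cong[of "B - A" p h]) (simp_all add: p_def)
  ultimately have "bij_betw p (A \<union> (B - A)) (f ` A \<union> (B - f ` A))"
    by (rule bij_betw_combine) blast
  moreover have "A \<union> (B - A) = B" "f ` A \<union> (B - f ` A) = B"
    using assms by auto
  ultimately have "p permutes B"
    using assms(2) by (intro bij_imp_permutes) (auto simp: p_def)
  then show thesis
    by (rule that) (simp add: p_def)
qed

text \<open>
  Relations need not preserve \<^term>\<open>act\<close>: the words \<open>te\<close> and \<open>s\<^sub>1e\<close> act differently. Therefore the map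
  belonging to an element is tracked by a relation (\<open>rep\<close> below), which turns out to be one-to-one on
  words without the letter \<^term>\<open>E\<close>.
\<close>

locale presented =
  fixes n :: nat and mult :: "'a \<Rightarrow> 'a \<Rightarrow> 'a" (infixl "\<cdot>" 70) and neutral :: 'a and g :: "letter \<Rightarrow> 'a"
  assumes n: "2 \<le> n"
    and assoc: "x \<cdot> y \<cdot> z = x \<cdot> (y \<cdot> z)"
    and neutral_left [simp]: "neutral \<cdot> x = x"
    and neutral_right [simp]: "x \<cdot> neutral = x"
    and relation: "(u, v) \<in> relations n \<Longrightarrow>
      foldr (\<lambda>c x. g c \<cdot> x) u neutral = foldr (\<lambda>c x. g c \<cdot> x) v neutral"
begin

abbreviation s :: "nat \<Rightarrow> 'a" where "s i \<equiv> g (S i)"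
abbreviation t :: 'a where "t \<equiv> g T"
abbreviation e :: 'a where "e \<equiv> g E"

section \<open>The defining relations in an arbitrary monoid\<close>

lemma s_s: "1 \<le> i \<Longrightarrow> i < n \<Longrightarrow> s i \<cdot> s i = neutral"
  using relation[of "[S i, S i]" "[]"] by (simp add: relations_def alphabet_def)

lemma s_s': "1 \<le> i \<Longrightarrow> i < n \<Longrightarrow> s i \<cdot> (s i \<cdot> x) = x"
  by (simp add: s_s flip: assoc)

lemma s_far:
  assumes "1 \<le> i" "i + 1 < j" "j < n"
  shows "s i \<cdot> s j = s j \<cdot> s i"
proof -
  have "([S i, S j], [S j, S i]) \<in> relations n"
    using assms by (simp add: relations_def alphabet_def)
  from relation[OF this] show ?thesis
    by simp
qed

lemma s_braid:
  assumes "1 \<le> i" "i + 1 < n"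
  shows "s i \<cdot> s (i + 1) \<cdot> s i = s (i + 1) \<cdot> s i \<cdot> s (i + 1)"
proof -
  have "([S i, S (i + 1), S i], [S (i + 1), S i, S (i + 1)]) \<in> relations n"
    using assms by (simp add: relations_def alphabet_def)
  from relation[OF this] show ?thesis
    by (simp add: assoc)
qed

lemma t_relations: "t \<cdot> t = t" "s 1 \<cdot> t = t" "e \<cdot> t = t"
  using n relation[of "[T, T]" "[T]"] relation[of "[T]" "[E, T]"] relation[of "[E, T]" "[S 1, T]"]
  by (simp_all add: relations_def alphabet_def)

lemma e_relations: "e \<cdot> e = e" "t \<cdot> e = e" "s 1 \<cdot> e = e" "e \<cdot> s 1 = e"
  using n relation[of "[E, E]" "[E]"] relation[of "[E]" "[T, E]"] relation[of "[T, E]" "[S 1, E]"]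
    relation[of "[S 1, E]" "[E, S 1]"]
  by (simp_all add: relations_def alphabet_def)

lemma s_t: "2 < i \<Longrightarrow> i < n \<Longrightarrow> s i \<cdot> t = t \<cdot> s i"
  using relation[of "[S i, T]" "[T, S i]"] by (simp add: relations_def alphabet_def)

lemma s_e: "2 < i \<Longrightarrow> i < n \<Longrightarrow> s i \<cdot> e = e \<cdot> s i"
  using relation[of "[S i, E]" "[E, S i]"] by (simp add: relations_def alphabet_def)

lemma relations_3:
  assumes "3 \<le> n"
  shows "t \<cdot> (s 1 \<cdot> (s 2 \<cdot> t)) = t \<cdot> (s 1 \<cdot> (s 2 \<cdot> s 1))"
    and "t \<cdot> (s 2 \<cdot> (t \<cdot> s 2)) = s 2 \<cdot> (t \<cdot> (s 2 \<cdot> t))"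
    and "e \<cdot> (s 2 \<cdot> (e \<cdot> s 2)) = s 2 \<cdot> (e \<cdot> (s 2 \<cdot> e))"
    and "t \<cdot> (s 2 \<cdot> (e \<cdot> s 2)) = s 2 \<cdot> (e \<cdot> (s 2 \<cdot> t))"
  using assms relation[of "[T, S 1, S 2, T]" "[T, S 1, S 2, S 1]"]
    relation[of "[T, S 2, T, S 2]" "[S 2, T, S 2, T]"]
    relation[of "[E, S 2, E, S 2]" "[S 2, E, S 2, E]"]
    relation[of "[T, S 2, E, S 2]" "[S 2, E, S 2, T]"]
  by (simp_all add: relations_def alphabet_def)

definition w :: 'a where "w = s 2 \<cdot> (s 3 \<cdot> (s 1 \<cdot> s 2))"

lemma relations_4:
  assumes "4 \<le> n"
  shows "t \<cdot> (w \<cdot> (t \<cdot> w)) = w \<cdot> (t \<cdot> (w \<cdot> t))"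
    and "e \<cdot> (w \<cdot> (e \<cdot> w)) = w \<cdot> (e \<cdot> (w \<cdot> e))"
    and "t \<cdot> (w \<cdot> (e \<cdot> w)) = w \<cdot> (e \<cdot> (w \<cdot> t))"
  using assms relation[of "[T] @ word_w @ [T] @ word_w" "word_w @ [T] @ word_w @ [T]"]
    relation[of "[E] @ word_w @ [E] @ word_w" "word_w @ [E] @ word_w @ [E]"]
    relation[of "[T] @ word_w @ [E] @ word_w" "word_w @ [E] @ word_w @ [T]"]
  by (simp_all add: relations_def alphabet_def word_w_def w_def assoc)

section \<open>Words with a given action, and the symmetric group\<close>

inductive rep :: "letter set \<Rightarrow> (nat \<Rightarrow> nat) \<Rightarrow> 'a \<Rightarrow> bool" for A where
  rep_neutral: "rep A id neutral"
| rep_step: "c \<in> A \<Longrightarrow> rep A f X \<Longrightarrow> rep A (f \<circ> letter_map c) (g c \<cdot> X)"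

lemma rep_mult: "rep A f X \<Longrightarrow> rep A h Y \<Longrightarrow> rep A (h \<circ> f) (X \<cdot> Y)"
proof (induction rule: rep.induct)
  case (rep_step c f X)
  have "rep A ((h \<circ> f) \<circ> letter_map c) (g c \<cdot> (X \<cdot> Y))"
    using rep_step(1) rep_step(3)[OF rep_step(4)] by (rule rep.rep_step)
  then show ?case
    by (simp only: assoc comp_assoc)
qed simp

lemma rep_letter: "c \<in> A \<Longrightarrow> rep A (letter_map c) (g c)"
  using rep_step[OF _ rep_neutral] by fastforce

lemma rep_mono: "rep A f X \<Longrightarrow> A \<subseteq> B \<Longrightarrow> rep B f X"
  by (induction rule: rep.induct) (auto intro: rep.intros)

lemma rep_empty: "rep {} f X \<Longrightarrow> f = id \<and> X = neutral"
  by (erule rep.cases) auto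

text \<open>The half-open range of indices yields the adjacent transpositions of the closed interval
  {a..b}.\<close>

definition swaps :: "nat \<Rightarrow> nat \<Rightarrow> letter set" where
  "swaps a b = {S i | i. a \<le> i \<and> i < b}"

lemma rep_swaps_permutes: "rep (swaps a b) f X \<Longrightarrow> f permutes {a..b}"
proof (induction rule: rep.induct)
  case (rep_step c f X)
  then have "letter_map c permutes {a..b}"
    by (auto simp: swaps_def intro!: permutes_swap_id)
  from permutes_compose[OF this rep_step(3)] show ?case .
qed (rule permutes_id)

text \<open>The product s_v s_{v+1} ... s_{v+m-1}, whose action carries v to v+m. With v+m = b+1
  these are coset representatives for the symmetric group on {a..b} inside the one on
  {a..b+1}.\<close>

primrec cyc :: "nat \<Rightarrow> nat \<Rightarrow> 'a" where
  "cyc v 0 = neutral"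
| "cyc v (Suc m) = s v \<cdot> cyc (v + 1) m"

definition cyc_map :: "nat \<Rightarrow> nat \<Rightarrow> nat \<Rightarrow> nat" where
  "cyc_map v m x = (if x = v then v + m else if v < x \<and> x \<le> v + m then x - 1 else x)"

lemma cyc_map_0: "cyc_map v 0 = id"
  by (auto simp: fun_eq_iff cyc_map_def)

lemma cyc_map_Suc: "cyc_map v (Suc m) = cyc_map (v + 1) m \<circ> transpose v (v + 1)"
  by (auto simp: fun_eq_iff cyc_map_def transpose_def)

lemma cyc_map_permutes: "cyc_map v m permutes {v..v + m}"
proof (induction m arbitrary: v)
  case (Suc m)
  have "cyc_map (v + 1) m permutes {v..v + Suc m}"
    using Suc[of "v + 1"] by (rule permutes_subset) auto
  then show ?case
    unfolding cyc_map_Suc by (intro permutes_compose permutes_swap_id) auto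
qed (simp add: cyc_map_0)

lemma rep_cyc: "rep (swaps v (v + m)) (cyc_map v m) (cyc v m)"
proof (induction m arbitrary: v)
  case 0
  then show ?case
    unfolding cyc_map_0 cyc.simps by (rule rep_neutral)
next
  case (Suc m)
  have "rep (swaps v (v + Suc m)) (cyc_map (v + 1) m) (cyc (v + 1) m)"
    using Suc[of "v + 1"] by (rule rep_mono) (auto simp: swaps_def)
  moreover have "S v \<in> swaps v (v + Suc m)"
    by (simp add: swaps_def)
  ultimately show ?case
    unfolding cyc_map_Suc cyc.simps letter_map.simps(1)[symmetric] by (intro rep_step)
qed

lemma left_commuteI: "x \<cdot> y = y \<cdot> x \<Longrightarrow> x \<cdot> (y \<cdot> z) = y \<cdot> (x \<cdot> z)"
  by (simp flip: assoc)

lemma cyc_far: "1 \<le> i \<Longrightarrow> i + 1 < v \<Longrightarrow> v + m \<le> n \<Longrightarrow> s i \<cdot> cyc v m = cyc v m \<cdot> s i"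
proof (induction m arbitrary: v)
  case (Suc m)
  then have "s i \<cdot> cyc v (Suc m) = s v \<cdot> (s i \<cdot> cyc (v + 1) m)"
    using left_commuteI[OF s_far[of i v]] by simp
  also have "\<dots> = cyc v (Suc m) \<cdot> s i"
    using Suc by (simp add: assoc)
  finally show ?case .
qed simp

text \<open>At i = v+1 the braid relation turns s_{v+1} s_v s_{v+1} into s_v s_{v+1} s_v, and the
  last s_v commutes with the rest of the cycle. For larger i, s_i commutes with s_v and the
  induction continues.\<close>

lemma cyc_shift:
  "1 \<le> v \<Longrightarrow> v < i \<Longrightarrow> i < v + m \<Longrightarrow> v + m \<le> n \<Longrightarrow> s i \<cdot> cyc v m = cyc v m \<cdot> s (i - 1)"
proof (induction m arbitrary: v)
  case (Suc m)
  show ?case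
  proof (cases "i = v + 1")
    case True
    with Suc.prems obtain k where k: "m = Suc k"
      by (cases m) auto
    have "s i \<cdot> cyc v (Suc m) = s (v + 1) \<cdot> s v \<cdot> s (v + 1) \<cdot> cyc (v + 2) k"
      using k True by (simp add: assoc)
    also have "\<dots> = s v \<cdot> s (v + 1) \<cdot> s v \<cdot> cyc (v + 2) k"
      using s_braid[of v] Suc.prems True by simp
    also have "\<dots> = s v \<cdot> s (v + 1) \<cdot> cyc (v + 2) k \<cdot> s v"
      using cyc_far[of v "v + 2" k] Suc.prems k by (simp add: assoc)
    finally show ?thesis
      using k True by (simp add: assoc)
  next
    case False
    then have "s i \<cdot> cyc v (Suc m) = s v \<cdot> (s i \<cdot> cyc (v + 1) m)"
      using left_commuteI[OF s_far[of v i, symmetric]] Suc.prems by simp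
    also have "\<dots> = cyc v (Suc m) \<cdot> s (i - 1)"
      using Suc False by (simp add: assoc)
    finally show ?thesis .
  qed
qed simp

text \<open>The invariant of a word, namely a cycle times an element of the smaller group, survives
  a new letter s_i on the left. If i+1 < v, the letter passes the cycle; if i+1 = v, it lengthens
  the cycle; if i = v, it cancels the first factor; if i > v, it passes with its index
  lowered.\<close>

lemma rep_swaps_decompose:
  assumes "1 \<le> a" "a \<le> b + 1" "b + 1 \<le> n" and "rep (swaps a (b + 1)) f X"
  shows "\<exists>v m h Y. a \<le> v \<and> v + m = b + 1 \<and> rep (swaps a b) h Y \<and>
    X = cyc v m \<cdot> Y \<and> f = h \<circ> cyc_map v m"
  using assms(4)
proof (induction rule: rep.induct)
  case rep_neutral
  show ?case
    by (intro exI[of _ "b + 1"] exI[of _ 0] exI[of _ id] exI[of _ neutral] conjI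
        assms(2) rep.rep_neutral) (simp_all add: cyc_map_0)
next
  case (rep_step c f X)
  then obtain v m h Y where X: "a \<le> v" "v + m = b + 1" "rep (swaps a b) h Y"
    "X = cyc v m \<cdot> Y" "f = h \<circ> cyc_map v m"
    by blast
  obtain i where i: "c = S i" "a \<le> i" "i < b + 1"
    using rep_step by (auto simp: swaps_def)
  consider "i + 1 < v" | "i + 1 = v" | "i = v" | "v < i"
    by linarith
  then show ?case
  proof cases
    case 1
    have "rep (swaps a b) (h \<circ> letter_map (S i)) (s i \<cdot> Y)"
      using X i 1 by (intro rep.rep_step) (auto simp: swaps_def)
    moreover have "s i \<cdot> X = cyc v m \<cdot> (s i \<cdot> Y)"
      using cyc_far[of i v m] X i 1 assms by (simp flip: assoc)
    moreover have "f \<circ> letter_map (S i) = h \<circ> letter_map (S i) \<circ> cyc_map v m"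
      using X 1 by (auto simp: fun_eq_iff cyc_map_def transpose_def)
    ultimately show ?thesis
      using X i by blast
  next
    case 2
    have "s i \<cdot> X = cyc i (Suc m) \<cdot> Y"
      using X 2 by (simp add: assoc)
    moreover have "f \<circ> letter_map (S i) = h \<circ> cyc_map i (Suc m)"
      using X 2 by (auto simp: cyc_map_Suc comp_assoc)
    moreover have "i + Suc m = b + 1"
      using X 2 by simp
    ultimately show ?thesis
      using X i by blast
  next
    case 3
    with X i obtain k where k: "m = Suc k"
      by (cases m) auto
    have "s i \<cdot> X = cyc (i + 1) k \<cdot> Y"
      using X 3 k i assms s_s'[of i] by (simp add: assoc)
    moreover have "f \<circ> letter_map (S i) = h \<circ> cyc_map (i + 1) k"
      using X 3 k by (simp add: cyc_map_Suc comp_assoc del: One_nat_def)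
    moreover have "i + 1 + k = b + 1" "a \<le> i + 1"
      using X 3 k by simp_all
    ultimately show ?thesis
      using X i by blast
  next
    case 4
    have "rep (swaps a b) (h \<circ> letter_map (S (i - 1))) (s (i - 1) \<cdot> Y)"
      using X i 4 by (intro rep.rep_step) (auto simp: swaps_def)
    moreover have "s i \<cdot> X = cyc v m \<cdot> (s (i - 1) \<cdot> Y)"
      using cyc_shift[of v i m] X i 4 assms by (simp flip: assoc)
    moreover have "f \<circ> letter_map (S i) = h \<circ> letter_map (S (i - 1)) \<circ> cyc_map v m"
      using X i 4 by (auto simp: fun_eq_iff cyc_map_def transpose_def)
    ultimately show ?thesis
      using X i by blast
  qed
qed

lemma swaps_empty: "b \<le> a \<Longrightarrow> swaps a b = {}"
  by (auto simp: swaps_def)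

text \<open>The factor from the smaller group fixes b+1, so v is the point that f carries to b+1.
  Hence f determines the cycle and, by cancelling its action, also the action of the other
  factor.\<close>

lemma rep_swaps_unique:
  "1 \<le> a \<Longrightarrow> b \<le> n \<Longrightarrow> rep (swaps a b) f X \<Longrightarrow> rep (swaps a b) f Y \<Longrightarrow> X = Y"
proof (induction b arbitrary: f X Y)
  case 0
  then show ?case
    using rep_empty by (metis swaps_empty zero_le)
next
  case (Suc b)
  show ?case
  proof (cases "a \<le> b + 1")
    case False
    with Suc show ?thesis
      using rep_empty by (metis swaps_empty Suc_eq_plus1 nat_le_linear)
  next
    case True
    obtain v m h Z where X: "v + m = b + 1" "rep (swaps a b) h Z"
      "X = cyc v m \<cdot> Z" "f = h \<circ> cyc_map v m"
      using rep_swaps_decompose[of a b f X] Suc.prems True by auto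
    obtain v' m' h' Z' where Y: "v' + m' = b + 1" "rep (swaps a b) h' Z'"
      "Y = cyc v' m' \<cdot> Z'" "f = h' \<circ> cyc_map v' m'"
      using rep_swaps_decompose[of a b f Y] Suc.prems True by auto
    have fixed: "h (b + 1) = b + 1" "h' (b + 1) = b + 1"
      using rep_swaps_permutes[OF X(2)] rep_swaps_permutes[OF Y(2)]
      by (simp_all add: permutes_not_in)
    have "f v = b + 1" "f v' = b + 1"
      by (subst X(4), use X(1) fixed in \<open>simp add: cyc_map_def\<close>)
         (subst Y(4), use Y(1) fixed in \<open>simp add: cyc_map_def\<close>)
    moreover have "inj f"
      using rep_swaps_permutes[OF Suc.prems(3)] by (rule permutes_inj)
    ultimately have "v = v'"
      by (metis injD)
    with X Y have m: "m = m'"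
      by simp
    have "surj (cyc_map v m)"
      using cyc_map_permutes by (rule permutes_surj)
    with X Y m \<open>v = v'\<close> have "h = h'"
      by (metis fun.map_comp comp_surj surj_fun_eq UNIV_I ext surjD comp_apply)
    with Suc X Y m \<open>v = v'\<close> show ?thesis
      by (metis Suc_leD)
  qed
qed

lemma rep_swaps_exists:
  "f permutes {a..b} \<Longrightarrow> \<exists>X. rep (swaps a b) f X"
proof (induction b arbitrary: f)
  case 0
  have "f = id"
    using permutes_subset[OF 0, of "{0}"] by fastforce
  then show ?case
    using rep_neutral by metis
next
  case (Suc b)
  show ?case
  proof (cases "a \<le> b + 1")
    case False
    with Suc.prems have "f = id"
      by simp
    then show ?thesis
      using rep_neutral by metis
  next
    case True
    obtain v where v: "v \<in> {a..Suc b}" "f v = Suc b"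
      using True permutes_image[OF Suc.prems] by (metis (no_types, lifting) Suc_eq_plus1 atLeastAtMost_iff imageE order_refl)
    define m where "m = Suc b - v"
    let ?c = "cyc_map v m"
    have vm: "v + m = Suc b"
      using v by (simp add: m_def)
    have c: "?c permutes {a..Suc b}"
      using cyc_map_permutes[of v m] by (rule permutes_subset) (use v vm in auto)
    \<comment> \<open>Removing the cycle that carries v to Suc b leaves a permutation fixing Suc
      b.\<close>
    define h where "h = f \<circ> inv_into UNIV ?c"
    have h: "h permutes {a..Suc b}"
      unfolding h_def using permutes_inv[OF c] Suc.prems by (rule permutes_compose)
    have "inv_into UNIV ?c (Suc b) = v"
      using vm permutes_inv_eq[OF c] by (simp add: cyc_map_def)
    then have "h (Suc b) = Suc b"
      using v by (simp add: h_def)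
    with h have "h permutes {a..b}"
      by (intro permutes_superset[OF h]) (auto simp: le_Suc_eq)
    with Suc.IH obtain Y where "rep (swaps a b) h Y"
      by blast
    then have "rep (swaps a (Suc b)) h Y"
      by (rule rep_mono) (auto simp: swaps_def)
    moreover have "rep (swaps a (Suc b)) ?c (cyc v m)"
      using rep_cyc by (rule rep_mono) (use v vm in \<open>auto simp: swaps_def\<close>)
    moreover have "h \<circ> ?c = f"
      unfolding h_def comp_assoc by (simp add: permutes_inv_o[OF c])
    ultimately show ?thesis
      by (metis rep_mult)
  qed
qed

section \<open>Permutations as elements, and conjugation by them\<close>

declare One_nat_def [simp del]

text \<open>Meaningful on permutations of {1..n}, by the existence and uniqueness just shown.
  Products appear as reversed compositions because the first letter of a word acts first.\<close>

definition P :: "(nat \<Rightarrow> nat) \<Rightarrow> 'a" where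
  "P p = (THE X. rep (swaps 1 n) p X)"

lemma P_eqI: "rep (swaps 1 n) p X \<Longrightarrow> P p = X"
  unfolding P_def using rep_swaps_unique[of 1 n p] by (intro the_equality) auto

lemma rep_P: "p permutes {1..n} \<Longrightarrow> rep (swaps 1 n) p (P p)"
  using rep_swaps_exists[of p 1 n] P_eqI by blast

lemma P_mult: "p permutes {1..n} \<Longrightarrow> q permutes {1..n} \<Longrightarrow> P p \<cdot> P q = P (q \<circ> p)"
  by (rule P_eqI[symmetric]) (intro rep_mult rep_P)

lemma P_mult': "p permutes {1..n} \<Longrightarrow> q permutes {1..n} \<Longrightarrow> P p \<cdot> (P q \<cdot> x) = P (q \<circ> p) \<cdot> x"
  by (simp add: P_mult flip: assoc)

lemma P_id [simp]: "P id = neutral"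
  by (rule P_eqI) (rule rep_neutral)

lemma P_transpose_Suc: "1 \<le> i \<Longrightarrow> i < n \<Longrightarrow> P (transpose i (i + 1)) = s i"
  using rep_letter[of "S i" "swaps 1 n"] by (intro P_eqI) (simp add: swaps_def)

lemma P_cancel:
  assumes p: "p permutes {1..n}" and "P p \<cdot> x = P p \<cdot> y"
  shows "x = y"
proof -
  have "P (inv_into UNIV p) \<cdot> (P p \<cdot> x) = P (inv_into UNIV p) \<cdot> (P p \<cdot> y)"
    using assms(2) by simp
  then show ?thesis
    by (simp add: P_mult' permutes_inv[OF p] p permutes_inv_o[OF p])
qed

text \<open>States y = p^{-1} x p without an inverse, so that products of conjugates follow by
  associativity alone.\<close>

definition conj :: "(nat \<Rightarrow> nat) \<Rightarrow> 'a \<Rightarrow> 'a \<Rightarrow> bool" where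
  "conj p x y \<longleftrightarrow> p permutes {1..n} \<and> x \<cdot> P p = P p \<cdot> y"

lemma conj_mult: "conj p x y \<Longrightarrow> conj p x' y' \<Longrightarrow> conj p (x \<cdot> x') (y \<cdot> y')"
  unfolding conj_def by (metis assoc)

lemma conj_unique: "conj p x y \<Longrightarrow> conj p x y' \<Longrightarrow> y = y'"
  unfolding conj_def using P_cancel by metis

lemma conj_neutral: "p permutes {1..n} \<Longrightarrow> conj p neutral neutral"
  by (simp add: conj_def)

lemma conj_comp:
  assumes "conj q x y" "conj p y z"
  shows "conj (p \<circ> q) x z"
proof -
  have p: "p permutes {1..n}" and q: "q permutes {1..n}"
    and xq: "x \<cdot> P q = P q \<cdot> y" and yp: "y \<cdot> P p = P p \<cdot> z"
    using assms by (auto simp: conj_def)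
  have "x \<cdot> P (p \<circ> q) = P q \<cdot> (y \<cdot> P p)"
    using xq P_mult[OF q p] by (metis assoc)
  also have "\<dots> = P (p \<circ> q) \<cdot> z"
    unfolding yp by (rule P_mult'[OF q p])
  finally show ?thesis
    using permutes_compose[OF q p] by (simp add: conj_def)
qed

lemma conj_cancel:
  assumes "conj q x y" "conj (p \<circ> q) x z" "p permutes {1..n}"
  shows "conj p y z"
proof -
  have q: "q permutes {1..n}"
    using assms by (simp add: conj_def)
  have "P q \<cdot> (y \<cdot> P p) = x \<cdot> P (p \<circ> q)"
    using assms P_mult[OF q assms(3)] unfolding conj_def by (metis assoc)
  also have "\<dots> = P q \<cdot> (P p \<cdot> z)"
    using assms P_mult'[OF q assms(3)] by (simp add: conj_def)
  finally show ?thesis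
    using P_cancel[OF q] assms(3) by (simp add: conj_def)
qed

lemma conj_P:
  assumes p: "p permutes {1..n}" and q: "q permutes {1..n}" and r: "r permutes {1..n}"
    and "p \<circ> q = r \<circ> p"
  shows "conj p (P q) (P r)"
  using assms by (simp add: conj_def P_mult)

lemma conj_P_transpose:
  assumes p: "p permutes {1..n}" and "i \<in> {1..n}" "j \<in> {1..n}"
  shows "conj p (P (transpose i j)) (P (transpose (p i) (p j)))"
proof (rule conj_P[OF p])
  show "transpose i j permutes {1..n}" "transpose (p i) (p j) permutes {1..n}"
    by (intro permutes_swap_id; simp only: permutes_in_image[OF p] assms)+
  show "p \<circ> transpose i j = transpose (p i) (p j) \<circ> p"
    using transpose_comp_eq[OF permutes_bij[OF p], of "p i" "p j"]
    by (simp only: permutes_inverses(2)[OF p])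
qed

lemma conj_exists:
  assumes p: "p permutes {1..n}"
  shows "\<exists>y. conj p x y"
proof
  show "conj p x (P (inv_into UNIV p) \<cdot> x \<cdot> P p)"
    using p by (simp add: conj_def assoc P_mult' permutes_inv[OF p] permutes_inv_o[OF p])
qed

text \<open>A permutation of {1..n} fixing 1 and 2 permutes {3..n}, so it is a product of letters
  s_i with i > 2, each of which commutes with x.\<close>

lemma conj_fixed_of_commute:
  assumes "\<And>i. 2 < i \<Longrightarrow> i < n \<Longrightarrow> s i \<cdot> x = x \<cdot> s i"
    and q: "q permutes {1..n}" "q 1 = 1" "q 2 = 2"
  shows "conj q x x"
proof -
  have comm: "x \<cdot> Y = Y \<cdot> x" if "rep (swaps 3 n) f Y" for f Y
    using that
  proof (induction rule: rep.induct)
    case (rep_step c f Y)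
    then obtain i where "c = S i" "2 < i" "i < n"
      by (auto simp: swaps_def)
    with assms(1)[of i] rep_step(3) show ?case
      by (metis assoc)
  qed simp
  have "q permutes {3..n}"
  proof (rule permutes_superset[OF q(1)])
    fix x assume "x \<in> {1..n} - {3..n}"
    then have "x = 1 \<or> x = 2"
      by auto
    with q show "q x = x"
      by auto
  qed
  then obtain Y where Y: "rep (swaps 3 n) q Y"
    using rep_swaps_exists by blast
  then have "rep (swaps 1 n) q Y"
    by (rule rep_mono) (auto simp: swaps_def)
  then have "P q = Y"
    by (rule P_eqI)
  with comm[OF Y] q(1) show ?thesis
    by (simp add: conj_def)
qed

text \<open>
  The choice of \<open>p\<close> does not matter when \<open>x\<close> commutes with \<open>s\<^sub>3, s\<^sub>4, \<dots>\<close>, which generate the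
  stabilizer of \<open>1\<close> and \<open>2\<close>; only then is \<open>place\<close> meaningful.
\<close>

definition place :: "'a \<Rightarrow> nat \<Rightarrow> nat \<Rightarrow> 'a" where
  "place x i j = (SOME y. \<exists>p. p 1 = i \<and> p 2 = j \<and> conj p x y)"

text \<open>The permutation q behind the chosen value and the given p differ by r = q^{-1} p, which
  fixes 1 and 2 and therefore conjugates x to itself.\<close>

lemma place_base:
  assumes comm: "\<And>i. 2 < i \<Longrightarrow> i < n \<Longrightarrow> s i \<cdot> x = x \<cdot> s i"
    and p: "p permutes {1..n}"
  shows "conj p x (place x (p 1) (p 2))"
proof -
  obtain y where y: "conj p x y"
    using conj_exists[OF p] by blast
  have "\<exists>q. q 1 = p 1 \<and> q 2 = p 2 \<and> conj q x (place x (p 1) (p 2))"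
    unfolding place_def by (rule someI[of _ y]) (use y in blast)
  then obtain q where q: "q 1 = p 1" "q 2 = p 2" "conj q x (place x (p 1) (p 2))"
    by blast
  then have q': "q permutes {1..n}"
    by (simp add: conj_def)
  define r where "r = inv_into UNIV q \<circ> p"
  have r: "r permutes {1..n}"
    unfolding r_def using p permutes_inv[OF q'] by (rule permutes_compose)
  have "r 1 = 1" "r 2 = 2"
    using permutes_inverses(2)[OF q', of 1] permutes_inverses(2)[OF q', of 2] q(1,2)
    by (simp_all add: r_def)
  then have "conj r x x"
    using comm r by (intro conj_fixed_of_commute)
  from conj_comp[OF this q(3)] have "conj (q \<circ> r) x (place x (p 1) (p 2))" .
  moreover have "q \<circ> r = p"
    unfolding r_def by (simp add: fun_eq_iff permutes_inverses(1)[OF q'])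
  ultimately show ?thesis
    by simp
qed

lemma exists_permutation_2:
  assumes "i \<in> {1..n}" "j \<in> {1..n}" "i \<noteq> j"
  obtains p where "p permutes {1..n}" "p 1 = i" "p 2 = j"
proof -
  let ?f = "\<lambda>x::nat. if x = 1 then i else j"
  have "inj_on ?f {1, 2}" "?f ` {1, 2} \<subseteq> {1..n}" "{1, 2} \<subseteq> {1..n}"
    using assms n by simp_all
  then obtain p where "p permutes {1..n}" "\<And>x. x \<in> {1, 2} \<Longrightarrow> p x = ?f x"
    using extend_to_permutation[of "{1..n}" "{1, 2}" ?f] by blast
  then show thesis
    by (intro that[of p]) simp_all
qed

lemma exists_permutation_3:
  assumes "i \<in> {1..n}" "j \<in> {1..n}" "k \<in> {1..n}" "distinct [i, j, k]"
  obtains p where "p permutes {1..n}" "p 1 = i" "p 2 = j" "p 3 = k" "3 \<le> n"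
proof -
  let ?f = "\<lambda>x::nat. if x = 1 then i else if x = 2 then j else k"
  have "card {i, j, k} \<le> card {1..n}"
    using assms by (intro card_mono) auto
  then have n3: "3 \<le> n"
    using assms by simp
  then have "inj_on ?f {1, 2, 3}" "?f ` {1, 2, 3} \<subseteq> {1..n}" "{1, 2, 3} \<subseteq> {1..n}"
    using assms by simp_all
  then obtain p where "p permutes {1..n}" "\<And>x. x \<in> {1, 2, 3} \<Longrightarrow> p x = ?f x"
    using extend_to_permutation[of "{1..n}" "{1, 2, 3}" ?f] by blast
  then show thesis
    using n3 by (intro that[of p]) simp_all
qed

lemma exists_permutation_4:
  assumes "i \<in> {1..n}" "j \<in> {1..n}" "k \<in> {1..n}" "l \<in> {1..n}" "distinct [i, j, k, l]"
  obtains p where "p permutes {1..n}" "p 1 = i" "p 2 = j" "p 3 = k" "p 4 = l" "4 \<le> n"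
proof -
  let ?f = "\<lambda>x::nat. if x = 1 then i else if x = 2 then j else if x = 3 then k else l"
  have "card {i, j, k, l} \<le> card {1..n}"
    using assms by (intro card_mono) auto
  then have n4: "4 \<le> n"
    using assms by simp
  then have "inj_on ?f {1, 2, 3, 4}" "?f ` {1, 2, 3, 4} \<subseteq> {1..n}" "{1, 2, 3, 4} \<subseteq> {1..n}"
    using assms by simp_all
  then obtain p where "p permutes {1..n}" "\<And>x. x \<in> {1, 2, 3, 4} \<Longrightarrow> p x = ?f x"
    using extend_to_permutation[of "{1..n}" "{1, 2, 3, 4}" ?f] by blast
  then show thesis
    using n4 by (intro that[of p]) simp_all
qed

text \<open>Both elements are conjugates of x, one by a q with q 1 = i and q 2 = j, the other by p
  after q; cancelling q leaves conjugation by p.\<close>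

lemma conj_place:
  assumes comm: "\<And>i. 2 < i \<Longrightarrow> i < n \<Longrightarrow> s i \<cdot> x = x \<cdot> s i"
    and p: "p permutes {1..n}" and ij: "i \<in> {1..n}" "j \<in> {1..n}" "i \<noteq> j"
  shows "conj p (place x i j) (place x (p i) (p j))"
proof -
  obtain q where q: "q permutes {1..n}" "q 1 = i" "q 2 = j"
    using exists_permutation_2[OF ij] by blast
  have "conj q x (place x i j)"
    using place_base[OF comm q(1)] q by simp
  moreover have "conj (p \<circ> q) x (place x (p i) (p j))"
    using place_base[OF comm permutes_compose[OF q(1) p]] q by simp
  ultimately show ?thesis
    using p by (rule conj_cancel)
qed

lemma place_1_2:
  assumes comm: "\<And>i. 2 < i \<Longrightarrow> i < n \<Longrightarrow> s i \<cdot> x = x \<cdot> s i"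
  shows "place x 1 2 = x"
  using place_base[OF comm permutes_id] by (simp add: conj_def)

section \<open>Conjugates of t and e\<close>

definition tt :: "nat \<Rightarrow> nat \<Rightarrow> 'a" where
  "tt = place t"

text \<open>A non-injective map can send i and j to the same point, and merging a point with itself
  has no effect. The value on the diagonal lets \<open>ee i j\<close> pass such maps without
  exceptions, as in et = t.\<close>

definition ee :: "nat \<Rightarrow> nat \<Rightarrow> 'a" where
  "ee i j = (if i = j then neutral else place e i j)"

lemma tt_1_2 [simp]: "tt 1 2 = t"
  using place_1_2[of t] s_t by (simp_all add: tt_def)

lemma ee_1_2 [simp]: "ee 1 2 = e"
  using place_1_2[of e] s_e by (simp_all add: ee_def)

lemma ee_same [simp]: "ee i i = neutral"
  by (simp add: ee_def)

lemma conj_tt: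
  "p permutes {1..n} \<Longrightarrow> i \<in> {1..n} \<Longrightarrow> j \<in> {1..n} \<Longrightarrow> i \<noteq> j \<Longrightarrow> conj p (tt i j) (tt (p i) (p j))"
  unfolding tt_def using s_t by (intro conj_place)

lemma conj_ee:
  assumes "p permutes {1..n}" "i \<in> {1..n}" "j \<in> {1..n}"
  shows "conj p (ee i j) (ee (p i) (p j))"
  using assms conj_place[of e p i j] s_e permutes_inj[OF assms(1)]
  by (auto simp: ee_def conj_neutral inj_eq)

lemma conjD: "conj p x y \<Longrightarrow> x \<cdot> P p = P p \<cdot> y"
  by (simp add: conj_def)

text \<open>Carries an identity at the points 1, 2, 3, 4 to any distinct points: both sides are
  conjugated by a permutation moving the former to the latter.\<close>

lemma transfer: "conj p x y \<Longrightarrow> conj p x' y' \<Longrightarrow> x = x' \<Longrightarrow> y = y'"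
  using conj_unique by blast

lemma tt_P:
  "p permutes {1..n} \<Longrightarrow> i \<in> {1..n} \<Longrightarrow> j \<in> {1..n} \<Longrightarrow> i \<noteq> j \<Longrightarrow> tt i j \<cdot> P p = P p \<cdot> tt (p i) (p j)"
  using conjD[OF conj_tt] .

lemma ee_P:
  "p permutes {1..n} \<Longrightarrow> i \<in> {1..n} \<Longrightarrow> j \<in> {1..n} \<Longrightarrow> ee i j \<cdot> P p = P p \<cdot> ee (p i) (p j)"
  using conjD[OF conj_ee] .

abbreviation sw :: "nat \<Rightarrow> nat \<Rightarrow> 'a" where "sw i j \<equiv> P (transpose i j)"

lemma sw_commute: "sw i j = sw j i"
  by (simp add: transpose_commute)

lemma sw_sw: "i \<in> {1..n} \<Longrightarrow> j \<in> {1..n} \<Longrightarrow> sw i j \<cdot> sw i j = neutral"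
  by (simp add: P_mult permutes_swap_id)

section \<open>Relations at the points 1, 2, 3, 4 and their conjugates\<close>

lemma s_eq_sw: "1 \<le> i \<Longrightarrow> i < n \<Longrightarrow> s i = sw i (i + 1)"
  by (rule P_transpose_Suc[symmetric])

lemma s_1_eq: "s 1 = sw 1 2"
  using s_eq_sw[of 1] n by simp

lemma s_2_eq: "3 \<le> n \<Longrightarrow> s 2 = sw 2 3"
  using s_eq_sw[of 2] by simp

lemma tt_sw:
  "i \<in> {1..n} \<Longrightarrow> j \<in> {1..n} \<Longrightarrow> k \<in> {1..n} \<Longrightarrow> l \<in> {1..n} \<Longrightarrow> i \<noteq> j \<Longrightarrow>
    tt i j \<cdot> sw k l = sw k l \<cdot> tt (transpose k l i) (transpose k l j)"
  by (intro tt_P permutes_swap_id)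

lemma ee_sw:
  "i \<in> {1..n} \<Longrightarrow> j \<in> {1..n} \<Longrightarrow> k \<in> {1..n} \<Longrightarrow> l \<in> {1..n} \<Longrightarrow>
    ee i j \<cdot> sw k l = sw k l \<cdot> ee (transpose k l i) (transpose k l j)"
  by (intro ee_P permutes_swap_id)

text \<open>Moving s_2 through t and e in the relations with s_2 and cancelling it leaves the three
  commutations. For the last identity, \<open>tt 2 3\<close> is moved through s_1 s_2, where it
  becomes t; the relation for t s_1 s_2 t and the braid relation then allow s_1 s_2 to be cancelled
  on the right.\<close>

lemma base_2_3:
  assumes n3: "3 \<le> n"
  shows "t \<cdot> tt 1 3 = tt 1 3 \<cdot> t" "e \<cdot> ee 1 3 = ee 1 3 \<cdot> e" "t \<cdot> ee 1 3 = ee 1 3 \<cdot> t"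
    "t \<cdot> tt 2 3 = t \<cdot> sw 2 3"
proof -
  have t: "t \<cdot> s 2 = s 2 \<cdot> tt 1 3"
    using tt_sw[of 1 2 2 3] n3 by (simp add: s_2_eq)
  have e: "e \<cdot> s 2 = s 2 \<cdot> ee 1 3"
    using ee_sw[of 1 2 2 3] n3 by (simp add: s_2_eq)
  have ss: "s 2 \<cdot> (s 2 \<cdot> x) = x" for x
    using s_s' n3 by simp
  have t': "t \<cdot> (s 2 \<cdot> x) = s 2 \<cdot> (tt 1 3 \<cdot> x)" and e': "e \<cdot> (s 2 \<cdot> x) = s 2 \<cdot> (ee 1 3 \<cdot> x)" for x
    using t e by (metis assoc)+
  show "t \<cdot> tt 1 3 = tt 1 3 \<cdot> t" "e \<cdot> ee 1 3 = ee 1 3 \<cdot> e" "t \<cdot> ee 1 3 = ee 1 3 \<cdot> t"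
    using relations_3(2-4)[OF n3] unfolding t e t' e' ss by simp_all
  have "tt 2 3 \<cdot> s 1 = s 1 \<cdot> tt 1 3"
    using tt_sw[of 2 3 1 2] n3 by (simp add: s_1_eq)
  moreover have "tt 1 3 \<cdot> s 2 = s 2 \<cdot> t"
    using tt_sw[of 1 3 2 3] n3 by (simp add: s_2_eq)
  ultimately have "t \<cdot> (tt 2 3 \<cdot> (s 1 \<cdot> s 2)) = t \<cdot> (s 1 \<cdot> (s 2 \<cdot> t))"
    by (metis assoc)
  also have "\<dots> = t \<cdot> (s 1 \<cdot> (s 2 \<cdot> s 1))"
    using relations_3(1)[OF n3] .
  also have "\<dots> = t \<cdot> (s 2 \<cdot> (s 1 \<cdot> s 2))"
    using s_braid[of 1] n3 by (simp add: assoc)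
  finally have "t \<cdot> (tt 2 3 \<cdot> (s 1 \<cdot> s 2)) \<cdot> s 2 \<cdot> s 1 = t \<cdot> (s 2 \<cdot> (s 1 \<cdot> s 2)) \<cdot> s 2 \<cdot> s 1"
    by simp
  then show "t \<cdot> tt 2 3 = t \<cdot> sw 2 3"
    using s_s[of 1] s_s'[of 2] n3 by (simp add: assoc flip: s_2_eq)
qed

lemma base_3_4:
  assumes n4: "4 \<le> n"
  shows "t \<cdot> tt 3 4 = tt 3 4 \<cdot> t" "e \<cdot> ee 3 4 = ee 3 4 \<cdot> e" "t \<cdot> ee 3 4 = ee 3 4 \<cdot> t"
proof -
  have s: "s 1 = sw 1 2" "s 2 = sw 2 3" "s 3 = sw 3 4"
    using s_eq_sw[of 1] s_eq_sw[of 2] s_eq_sw[of 3] n4 by simp_all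
  \<comment> \<open>The letters of w in reverse order, since \<open>P\<close> reverses
    compositions.\<close>
  let ?p = "transpose 2 3 \<circ> (transpose 1 2 \<circ> (transpose 3 4 \<circ> transpose (2::nat) 3))"
  have perm: "transpose 1 2 permutes {1..n}" "transpose 2 3 permutes {1..n}" "transpose 3 4 permutes {1..n}"
    using n4 by (auto intro!: permutes_swap_id)
  have p: "?p permutes {1..n}"
    using perm by (intro permutes_compose)
  have w: "w = P ?p"
    unfolding w_def s using perm by (simp add: P_mult permutes_compose comp_assoc)
  have t: "t \<cdot> w = w \<cdot> tt 3 4"
    using tt_P[OF p, of 1 2] n4 unfolding w by (simp add: transpose_def)
  have e: "e \<cdot> w = w \<cdot> ee 3 4"
    using ee_P[OF p, of 1 2] n4 unfolding w by (simp add: transpose_def)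
  have "s 3 \<cdot> (s 1 \<cdot> x) = s 1 \<cdot> (s 3 \<cdot> x)" for x
    using left_commuteI[OF s_far[of 1 3]] n4 by simp
  \<comment> \<open>w is an involution because s_1 and s_3 commute.\<close>
  then have ww: "w \<cdot> (w \<cdot> x) = x" for x
    unfolding w_def using s_s' n4 by (simp add: assoc)
  have t': "t \<cdot> (w \<cdot> x) = w \<cdot> (tt 3 4 \<cdot> x)" and e': "e \<cdot> (w \<cdot> x) = w \<cdot> (ee 3 4 \<cdot> x)" for x
    using t e by (metis assoc)+
  show "t \<cdot> tt 3 4 = tt 3 4 \<cdot> t" "e \<cdot> ee 3 4 = ee 3 4 \<cdot> e" "t \<cdot> ee 3 4 = ee 3 4 \<cdot> t"
    using relations_4[OF n4] unfolding t e t' e' ww by simp_all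
qed

lemma conj_tt_base: "p permutes {1..n} \<Longrightarrow> conj p t (tt (p 1) (p 2))"
  using conj_tt[of p 1 2] n by simp

lemma conj_ee_base: "p permutes {1..n} \<Longrightarrow> conj p e (ee (p 1) (p 2))"
  using conj_ee[of p 1 2] n by simp

lemma pair_relations:
  assumes "i \<in> {1..n}" "j \<in> {1..n}" "i \<noteq> j"
  shows tt_idem: "tt i j \<cdot> tt i j = tt i j"
    and sw_tt: "sw i j \<cdot> tt i j = tt i j"
    and ee_idem: "ee i j \<cdot> ee i j = ee i j"
    and tt_ee: "tt i j \<cdot> ee i j = ee i j"
    and sw_ee: "sw i j \<cdot> ee i j = ee i j"
    and ee_sw_same: "ee i j \<cdot> sw i j = ee i j"
proof -
  obtain p where p: "p permutes {1..n}" "p 1 = i" "p 2 = j"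
    using exists_permutation_2[OF assms] by blast
  have conj: "conj p t (tt i j)" "conj p e (ee i j)" "conj p (s 1) (sw i j)"
    using conj_tt_base[OF p(1)] conj_ee_base[OF p(1)] conj_P_transpose[OF p(1), of 1 2] n p(2,3)
    by (simp_all add: s_1_eq)
  show "tt i j \<cdot> tt i j = tt i j" "sw i j \<cdot> tt i j = tt i j"
    "ee i j \<cdot> ee i j = ee i j" "tt i j \<cdot> ee i j = ee i j" "sw i j \<cdot> ee i j = ee i j"
    "ee i j \<cdot> sw i j = ee i j"
    by (rule transfer[of p], (rule conj_mult conj)+, rule t_relations e_relations)+
qed

lemma triple_relations:
  assumes "i \<in> {1..n}" "j \<in> {1..n}" "k \<in> {1..n}" "distinct [i, j, k]"
  shows tt_tt_commute: "tt i j \<cdot> tt i k = tt i k \<cdot> tt i j"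
    and ee_ee_commute: "ee i j \<cdot> ee i k = ee i k \<cdot> ee i j"
    and tt_ee_commute: "tt i j \<cdot> ee i k = ee i k \<cdot> tt i j"
    and tt_tt_chain: "tt i j \<cdot> tt j k = tt i j \<cdot> sw j k"
proof -
  obtain p where p: "p permutes {1..n}" "p 1 = i" "p 2 = j" "p 3 = k" and n3: "3 \<le> n"
    using exists_permutation_3[OF assms] by blast
  have conj: "conj p t (tt i j)" "conj p e (ee i j)" "conj p (sw 2 3) (sw j k)"
    "conj p (tt 1 3) (tt i k)" "conj p (ee 1 3) (ee i k)" "conj p (tt 2 3) (tt j k)"
    using conj_tt_base[OF p(1)] conj_ee_base[OF p(1)] conj_P_transpose[OF p(1), of 2 3]
      conj_tt[OF p(1), of 1 3] conj_ee[OF p(1), of 1 3] conj_tt[OF p(1), of 2 3] n3 p(2-)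
    by simp_all
  show "tt i j \<cdot> tt i k = tt i k \<cdot> tt i j" "ee i j \<cdot> ee i k = ee i k \<cdot> ee i j"
    "tt i j \<cdot> ee i k = ee i k \<cdot> tt i j" "tt i j \<cdot> tt j k = tt i j \<cdot> sw j k"
    by (rule transfer[of p], (rule conj_mult conj)+, rule base_2_3[OF n3])+
qed

lemma quadruple_relations:
  assumes "i \<in> {1..n}" "j \<in> {1..n}" "k \<in> {1..n}" "l \<in> {1..n}" "distinct [i, j, k, l]"
  shows tt_tt_disjoint: "tt i j \<cdot> tt k l = tt k l \<cdot> tt i j"
    and ee_ee_disjoint: "ee i j \<cdot> ee k l = ee k l \<cdot> ee i j"
    and tt_ee_disjoint: "tt i j \<cdot> ee k l = ee k l \<cdot> tt i j"
proof -
  obtain p where p: "p permutes {1..n}" "p 1 = i" "p 2 = j" "p 3 = k" "p 4 = l" and n4: "4 \<le> n"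
    using exists_permutation_4[OF assms] by blast
  have conj: "conj p t (tt i j)" "conj p e (ee i j)" "conj p (tt 3 4) (tt k l)" "conj p (ee 3 4) (ee k l)"
    using conj_tt_base[OF p(1)] conj_ee_base[OF p(1)] conj_tt[OF p(1), of 3 4] conj_ee[OF p(1), of 3 4]
      n4 p(2-)
    by simp_all
  show "tt i j \<cdot> tt k l = tt k l \<cdot> tt i j" "ee i j \<cdot> ee k l = ee k l \<cdot> ee i j"
    "tt i j \<cdot> ee k l = ee k l \<cdot> tt i j"
    by (rule transfer[of p], (rule conj_mult conj)+, rule base_3_4[OF n4])+
qed

lemma tt_sw_same: "i \<in> {1..n} \<Longrightarrow> j \<in> {1..n} \<Longrightarrow> i \<noteq> j \<Longrightarrow> tt i j \<cdot> sw i j = tt j i"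
  using tt_sw[of i j i j] sw_tt[of j i] by (simp add: sw_commute[of j i])

text \<open>Conjugation by the transposition of i and j exchanges the indices, but that
  transposition is absorbed by \<open>ee i j\<close> on either side.\<close>

lemma ee_commute: "i \<in> {1..n} \<Longrightarrow> j \<in> {1..n} \<Longrightarrow> ee i j = ee j i"
  using ee_sw[of i j i j] ee_sw_same[of i j] sw_ee[of j i] by (cases "i = j") (auto simp: sw_commute[of j i])

context
  fixes i j k
  assumes ijk: "i \<in> {1..n}" "j \<in> {1..n}" "k \<in> {1..n}" "distinct [i, j, k]"
begin

text \<open>Writing \<open>tt i j\<close> as \<open>tt j i\<close> times a transposition gives both
  factors the same first index, where they commute.\<close>

lemma tt_tt_merge: "tt j k \<cdot> tt i j = tt i j \<cdot> tt i k"
proof -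
  have "tt j k \<cdot> tt i j = tt j k \<cdot> tt j i \<cdot> sw i j"
    using ijk tt_sw_same[of j i] by (simp add: assoc sw_commute[of i j])
  also have "\<dots> = tt j i \<cdot> (tt j k \<cdot> sw i j)"
    using ijk tt_tt_commute[of j k i] by (simp add: assoc)
  also have "\<dots> = tt j i \<cdot> sw i j \<cdot> tt i k"
    using ijk tt_sw[of j k i j] by (simp add: assoc)
  also have "\<dots> = tt i j \<cdot> tt i k"
    using ijk tt_sw_same[of j i] by (simp add: sw_commute[of i j])
  finally show ?thesis .
qed

text \<open>After \<open>tt i j\<close> no point lies at j, so sending j elsewhere changes nothing.
  Formally, \<open>tt k j\<close> is \<open>tt j k\<close> times a transposition, and the chain rule
  makes this transposition cancel.\<close>

lemma tt_tt_absorb: "tt i j \<cdot> tt k j = tt i j"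
proof -
  have "tt i j \<cdot> tt k j = tt i j \<cdot> tt j k \<cdot> sw j k"
    using ijk tt_sw_same[of j k] by (simp add: assoc)
  also have "\<dots> = tt i j"
    using ijk tt_tt_chain[of i j k] sw_sw[of j k] by (simp add: assoc)
  finally show ?thesis .
qed

text \<open>\<open>ee i j\<close> absorbs the transposition of i and j, which turns
  \<open>ee j k\<close> into \<open>ee i k\<close>. This is transitivity of merging.\<close>

lemma ee_ee_chain: "ee i j \<cdot> ee j k = ee i j \<cdot> ee i k"
proof -
  have ji: "ee i j = ee j i"
    using ijk by (intro ee_commute)
  have "ee i j \<cdot> ee i k = ee i j \<cdot> sw i j \<cdot> ee i k"
    using ijk ee_sw_same[of i j] by simp
  also have "\<dots> = ee i j \<cdot> (ee j k \<cdot> sw i j)"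
    using ijk ee_sw[of j k i j] by (simp add: assoc)
  also have "\<dots> = ee j k \<cdot> (ee i j \<cdot> sw i j)"
    using ijk ee_ee_commute[of j i k] ji by (simp flip: assoc)
  also have "\<dots> = ee i j \<cdot> ee j k"
    using ijk ee_sw_same[of i j] ee_ee_commute[of j i k] ji by simp
  finally show ?thesis ..
qed

end

text \<open>After \<open>tt i j\<close> and \<open>tt l k\<close> both j and k are vacant, so
  exchanging them is invisible. The case i = l is included.\<close>

lemma tt_tt_sw:
  assumes "i \<in> {1..n}" "j \<in> {1..n}" "k \<in> {1..n}" "l \<in> {1..n}" "distinct [i, j, k]" "distinct [l, j, k]"
  shows "tt i j \<cdot> (tt l k \<cdot> sw j k) = tt i j \<cdot> tt l k"
proof -
  have "tt i j \<cdot> (tt l k \<cdot> sw j k) = tt i j \<cdot> sw j k \<cdot> tt l j"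
    using assms tt_sw[of l k j k] by (simp add: assoc)
  also have "\<dots> = tt i j \<cdot> (tt j k \<cdot> tt l j)"
    using assms tt_tt_chain[of i j k] by (simp flip: assoc)
  also have "\<dots> = tt i j \<cdot> tt l j \<cdot> tt l k"
    using assms tt_tt_merge[of l j k] by (simp add: assoc)
  also have "tt i j \<cdot> tt l j = tt i j"
    using assms tt_tt_absorb[of i j l] tt_idem[of i j] by (cases "i = l") auto
  finally show ?thesis .
qed

lemma ee_ee:
  assumes "i \<in> {1..n}" "j \<in> {1..n}" "k \<in> {1..n}" "l \<in> {1..n}"
  shows "ee i j \<cdot> ee k l = ee k l \<cdot> ee i j"
proof -
  have share: "ee a b \<cdot> ee a c = ee a c \<cdot> ee a b" if "a \<in> {1..n}" "b \<in> {1..n}" "c \<in> {1..n}" for a b c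
    using that ee_ee_commute[of a b c] by (cases "a = b \<or> a = c \<or> b = c") auto
  consider "i = j" | "k = l" | "i = k" | "i = l" | "j = k" | "j = l" | "distinct [i, j, k, l]"
    by auto
  then show ?thesis
  proof cases
    case 7
    then show ?thesis
      by (rule ee_ee_disjoint[OF assms])
  next
    case 3
    with assms share[of i j l] show ?thesis
      by simp
  next
    case 4
    with assms share[of i j k] show ?thesis
      using ee_commute[of k i] by simp
  next
    case 5
    with assms share[of j i l] show ?thesis
      using ee_commute[of i j] by simp
  next
    case 6
    with assms share[of j i k] show ?thesis
      using ee_commute[of i j] ee_commute[of k j] by simp
  qed simp_all
qed

text \<open>For i < j the position relative to {1, 2} selects the rule: et = t for the pair (1, 2),
  commutation at overlapping or disjoint pairs otherwise. The case i = 2 reduces to i = 1 through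
  s_1 t = t.\<close>

lemma ee_T:
  assumes "i \<in> {1..n}" "j \<in> {1..n}"
  shows "ee i j \<cdot> t = t \<cdot> ee (letter_map T i) (letter_map T j)"
proof -
  have less: "ee i j \<cdot> t = t \<cdot> ee (letter_map T i) (letter_map T j)"
    if ij: "i < j" "i \<in> {1..n}" "j \<in> {1..n}" for i j
  proof -
    have n2: "2 \<in> {1..n}" "1 \<in> {1..n}"
      using n by simp_all
    consider "i = 1" "j = 2" | "i = 1" "3 \<le> j" | "i = 2" "3 \<le> j" | "3 \<le> i" "3 \<le> j"
      using ij by force
    then show ?thesis
    proof cases
      case 1
      then show ?thesis
        by (simp add: t_relations)
    next
      case 2
      then show ?thesis
        using tt_ee_commute[of 1 2 j] ij n2 by simp
    next
      case 3
      have "ee 2 j \<cdot> t = ee 2 j \<cdot> sw 1 2 \<cdot> t"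
        using t_relations(2) by (simp add: assoc s_1_eq)
      also have "\<dots> = sw 1 2 \<cdot> (ee 1 j \<cdot> t)"
        using ee_sw[of 2 j 1 2] 3 ij n2 by (simp add: assoc)
      also have "ee 1 j \<cdot> t = t \<cdot> ee 1 j"
        using tt_ee_commute[of 1 2 j] 3 ij n2 by simp
      also have "sw 1 2 \<cdot> (t \<cdot> ee 1 j) = t \<cdot> ee 1 j"
        using t_relations(2) by (simp add: s_1_eq flip: assoc)
      finally show ?thesis
        using 3 by simp
    next
      case 4
      then show ?thesis
        using tt_ee_disjoint[of 1 2 i j] ij n2 by simp
    qed
  qed
  have in': "letter_map T i \<in> {1..n}" if "i \<in> {1..n}" for i
    using that n by auto
  consider "i < j" | "i = j" | "j < i"
    by linarith
  then show ?thesis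
    using less[OF _ assms] less[OF _ assms(2,1)] ee_commute[OF assms]
      ee_commute[OF in'[OF assms(1)] in'[OF assms(2)]]
    by cases simp_all
qed

section \<open>The full transformation monoid\<close>

abbreviation st :: "letter set" where "st \<equiv> insert T (swaps 1 n)"

text \<open>Points outside {1..n} are fixed so that transformations agreeing on {1..n} are equal as
  functions on \<open>nat\<close>.\<close>

definition self_map :: "(nat \<Rightarrow> nat) \<Rightarrow> bool" where
  "self_map f \<longleftrightarrow> (\<forall>x\<in>{1..n}. f x \<in> {1..n}) \<and> (\<forall>x. x \<notin> {1..n} \<longrightarrow> f x = x)"

lemma self_mapD: "self_map f \<Longrightarrow> x \<in> {1..n} \<Longrightarrow> f x \<in> {1..n}"
  unfolding self_map_def by blast

lemma self_map_comp: "self_map f \<Longrightarrow> self_map h \<Longrightarrow> self_map (h \<circ> f)"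
  by (simp add: self_map_def)

lemma self_map_permutes: "p permutes {1..n} \<Longrightarrow> self_map p"
  unfolding self_map_def using permutes_in_image permutes_not_in by metis

lemma letter_cases:
  assumes "c \<in> st"
  obtains "c = T" | k where "c = S k" "1 \<le> k" "k < n" "k \<in> {1..n}" "k + 1 \<in> {1..n}" "g c = sw k (k + 1)"
    "letter_map c = transpose k (k + 1)"
  using assms s_eq_sw by (force simp: swaps_def)

lemma self_map_letter: "c \<in> st \<Longrightarrow> self_map (letter_map c)"
proof (erule letter_cases)
  assume "c = T"
  then show ?thesis
    using n by (auto simp: self_map_def)
next
  fix k assume "k \<in> {1..n}" "k + 1 \<in> {1..n}" "letter_map c = transpose k (k + 1)"
  then show ?thesis
    by (simp only: self_map_permutes permutes_swap_id)
qed

lemma rep_self_map: "rep st f X \<Longrightarrow> self_map f"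
proof (induction rule: rep.induct)
  case rep_neutral
  show ?case
    by (simp add: self_map_def)
next
  case (rep_step c f X)
  from self_map_comp[OF self_map_letter[OF rep_step(1)] rep_step(3)] show ?case .
qed

lemma rep_st_P: "p permutes {1..n} \<Longrightarrow> rep st p (P p)"
  by (rule rep_mono[OF rep_P]) auto

lemma rep_st_sw: "i \<in> {1..n} \<Longrightarrow> j \<in> {1..n} \<Longrightarrow> rep st (transpose i j) (sw i j)"
  by (intro rep_st_P permutes_swap_id)

lemma rep_st_t: "rep st (letter_map T) t"
  by (intro rep_letter) simp

lemma rep_st_tt:
  assumes "i \<in> {1..n}" "j \<in> {1..n}" "i \<noteq> j"
  shows "rep st (id(j := i)) (tt i j)"
proof -
  obtain p where p: "p permutes {1..n}" "p 1 = i" "p 2 = j"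
    using exists_permutation_2[OF assms] by blast
  let ?q = "inv_into UNIV p"
  have q: "?q permutes {1..n}"
    using permutes_inv[OF p(1)] .
  have "t \<cdot> P p = P p \<cdot> tt i j"
    using conjD[OF conj_tt_base[OF p(1)]] p by simp
  then have "P ?q \<cdot> (t \<cdot> P p) = tt i j"
    using p q by (simp add: P_mult' permutes_inv_o)
  moreover have "rep st ((p \<circ> letter_map T) \<circ> ?q) (P ?q \<cdot> (t \<cdot> P p))"
    by (intro rep_mult rep_st_P rep_st_t p(1) q)
  moreover have "(p \<circ> letter_map T) \<circ> ?q = id(j := i)"
    using p permutes_inverses[OF p(1)] by (auto simp: fun_eq_iff permutes_inv_eq)
  ultimately show ?thesis
    by simp
qed

text \<open>The three positions of i are a shared first index, a chain through 2 and disjoint pairs.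
  The bound on j ensures that t fixes it and sends no other point to it.\<close>

lemma tt_T:
  assumes "i \<in> {1..n}" "j \<in> {1..n}" "3 \<le> j" "i \<noteq> j"
  shows "tt i j \<cdot> t = t \<cdot> tt (letter_map T i) j"
proof -
  have n2: "2 \<in> {1..n}" "1 \<in> {1..n}"
    using n by simp_all
  consider "i = 1" | "i = 2" | "3 \<le> i"
    using assms by force
  then show ?thesis
  proof cases
    case 1
    then show ?thesis
      using tt_tt_commute[of 1 2 j] assms n2 by simp
  next
    case 2
    then show ?thesis
      using tt_tt_merge[of 1 2 j] assms n2 by simp
  next
    case 3
    then show ?thesis
      using tt_tt_disjoint[of 1 2 i j] assms n2 by simp
  qed
qed

text \<open>If X absorbs \<open>tt i j\<close>, it absorbs the transposition of i and j as well, and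
  \<open>tt j i\<close> is the product of these two.\<close>

lemma tt_absorb_swap:
  assumes "i \<in> {1..n}" "j \<in> {1..n}" "i \<noteq> j" "tt i j \<cdot> X = X"
  shows "tt j i \<cdot> X = X"
proof -
  have "sw i j \<cdot> X = X"
    using assms sw_tt[of i j] by (metis assoc)
  then show ?thesis
    using assms tt_sw_same[of i j] by (metis assoc)
qed

text \<open>Moved past the first letter, \<open>tt i j\<close> becomes the corresponding element at
  the image points, which f still identifies. Only the pair {1, 2} in front of t is different: there
  t t = t applies.\<close>

lemma tt_absorb:
  "rep st f X \<Longrightarrow> i \<in> {1..n} \<Longrightarrow> j \<in> {1..n} \<Longrightarrow> i \<noteq> j \<Longrightarrow> f i = f j \<Longrightarrow> tt i j \<cdot> X = X"
proof (induction arbitrary: i j rule: rep.induct)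
  case (rep_step c f X)
  from rep_step(1) show ?case
  proof (cases rule: letter_cases)
    case 1
    have far: "tt i j \<cdot> (t \<cdot> X) = t \<cdot> X"
      if "i \<in> {1..n}" "j \<in> {1..n}" "i \<noteq> j" "3 \<le> j" "f (letter_map T i) = f (letter_map T j)" for i j
    proof -
      have "tt i j \<cdot> (t \<cdot> X) = t \<cdot> (tt (letter_map T i) j \<cdot> X)"
        using tt_T[of i j] that by (metis assoc)
      also have "tt (letter_map T i) j \<cdot> X = X"
        using that n by (intro rep_step.IH) auto
      finally show ?thesis .
    qed
    have near: "tt 1 2 \<cdot> (t \<cdot> X) = t \<cdot> X"
      using t_relations(1) by (simp flip: assoc)
    have "i \<in> {1, 2} \<or> 3 \<le> i" "j \<in> {1, 2} \<or> 3 \<le> j"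
      using rep_step.prems by force+
    with rep_step.prems(3) consider "3 \<le> j" | "3 \<le> i" | "i = 1" "j = 2" | "i = 2" "j = 1"
      by blast
    then have "tt i j \<cdot> (t \<cdot> X) = t \<cdot> X"
    proof cases
      case 1
      with far rep_step.prems \<open>c = T\<close> show ?thesis
        by simp
    next
      case 2
      with rep_step.prems \<open>c = T\<close> show ?thesis
        by (intro tt_absorb_swap[of j i] far) auto
    next
      case 3
      with near show ?thesis
        by simp
    next
      case 4
      with near n show ?thesis
        by (intro tt_absorb_swap[of j i]) auto
    qed
    with 1 show ?thesis
      by simp
  next
    case (2 k)
    have tr: "transpose k (k + 1) permutes {1..n}"
      using 2 by (intro permutes_swap_id)
    have "tt i j \<cdot> (g c \<cdot> X) = g c \<cdot> (tt (letter_map c i) (letter_map c j) \<cdot> X)"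
      unfolding 2(6,7) using tt_P[OF tr] rep_step.prems by (metis assoc)
    also have "tt (letter_map c i) (letter_map c j) \<cdot> X = X"
      unfolding 2(7) using rep_step.prems permutes_in_image[OF tr] permutes_inj[OF tr]
      by (intro rep_step.IH) (simp_all only: comp_apply 2(7) inj_eq not_False_eq_True)
    finally show ?thesis .
  qed
qed simp

text \<open>
  The value at \<open>y\<close> is irrelevant after \<open>tt x y\<close>, so it may be moved to a point \<open>z\<close> outside the image.
\<close>

lemma tt_move:
  "rep st f X \<Longrightarrow> x \<in> {1..n} \<Longrightarrow> y \<in> {1..n} \<Longrightarrow> x \<noteq> y \<Longrightarrow> z \<in> {1..n} \<Longrightarrow> z \<notin> f ` {1..n} \<Longrightarrow>
    \<exists>V. rep st (f(y := z)) V \<and> tt x y \<cdot> X = tt x y \<cdot> V"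
proof (induction arbitrary: x y rule: rep.induct)
  case (rep_step c f X)
  note x = \<open>x \<in> {1..n}\<close> and y = \<open>y \<in> {1..n}\<close> and xy = \<open>x \<noteq> y\<close> and z = \<open>z \<in> {1..n}\<close>
  from rep_step(1) show ?case
  proof (cases rule: letter_cases)
    case 1
    have n2: "2 \<in> {1..n}" "1 \<in> {1..n}"
      using n by simp_all
    \<comment> \<open>The image of T misses only 2 within {1..n}, so z can be a value of f at 2
      only. The induction hypothesis is available unless z = f 2.\<close>
    have z': "z \<noteq> f k" if "k \<in> {1..n}" "k \<noteq> 2" for k
    proof -
      have "f k = (f \<circ> letter_map c) k"
        using that 1 by simp
      with \<open>z \<notin> (f \<circ> letter_map c) ` {1..n}\<close> that(1) show ?thesis
        by blast
    qed
    have IH: "\<exists>V. rep st (f(b := z)) V \<and> tt a b \<cdot> X = tt a b \<cdot> V"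
      if "a \<in> {1..n}" "b \<in> {1..n}" "a \<noteq> b" "z \<noteq> f 2" for a b
      using rep_step.IH[OF that(1-3) z] z' that(4) by blast
    have "y \<in> {1, 2} \<or> 3 \<le> y"
      using y by force
    then consider "y = 2" | "y = 1" | "3 \<le> y"
      by blast
    then have "\<exists>V. rep st ((f \<circ> letter_map T)(y := z)) V \<and> tt x y \<cdot> (t \<cdot> X) = tt x y \<cdot> V"
    proof cases
      case 1
      have "tt x 2 \<cdot> t = tt x 2"
        using tt_idem[of 1 2] tt_tt_absorb[of x 2 1] x xy n2 1 by (cases "x = 1") auto
      then have *: "tt x 2 \<cdot> (t \<cdot> X) = tt x 2 \<cdot> X"
        by (simp flip: assoc)
      have upd: "(f \<circ> letter_map T)(2 := z) = f(2 := z)"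
        by (auto simp: fun_eq_iff)
      show ?thesis
      proof (cases "z = f 2")
        case True
        then have "f(2 := z) = f"
          by simp
        with True 1 * upd rep_step(2) show ?thesis
          by metis
      next
        case False
        with IH[of x 2] x n2 xy 1 * upd show ?thesis
          by metis
      qed
    next
      case 2
      \<comment> \<open>Once 1 has been vacated, t may be replaced by the transposition of 1 and 2,
        which reduces the case y = 1 to y = 2.\<close>
      have "tt x 1 \<cdot> t = tt x 1 \<cdot> sw 1 2"
      proof (cases "x = 2")
        case True
        have "tt 2 1 \<cdot> t = t \<cdot> (sw 1 2 \<cdot> t)"
          using tt_sw_same[of 1 2] n2 by (simp flip: assoc)
        also have "\<dots> = tt 2 1 \<cdot> sw 1 2"
          using sw_tt[of 1 2] tt_idem[of 1 2] tt_sw_same[of 2 1] n2 by (simp add: sw_commute[of 2 1])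
        finally show ?thesis
          using True by simp
      next
        case False
        then show ?thesis
          using tt_tt_chain[of x 1 2] x xy n2 2 by simp
      qed
      then have *: "tt x 1 \<cdot> (t \<cdot> X) = tt x 1 \<cdot> (sw 1 2 \<cdot> X)"
        by (simp flip: assoc)
      have upd: "(f \<circ> letter_map T)(1 := z) = f(2 := z) \<circ> transpose 1 2"
        by (auto simp: fun_eq_iff transpose_def)
      have sw: "tt x 1 \<cdot> (sw 1 2 \<cdot> Y) = sw 1 2 \<cdot> (tt (transpose 1 2 x) 2 \<cdot> Y)" for Y
        using tt_sw[of x 1 1 2] x n2 xy 2 by (simp flip: assoc)
      have "\<exists>V. rep st (f(2 := z)) V \<and> tt (transpose 1 2 x) 2 \<cdot> X = tt (transpose 1 2 x) 2 \<cdot> V"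
      proof (cases "z = f 2")
        case True
        then have "f(2 := z) = f"
          by simp
        with rep_step(2) show ?thesis
          by metis
      next
        case False
        then show ?thesis
          by (intro IH) (use x n2 xy 2 in \<open>auto simp: transpose_def\<close>)
      qed
      then obtain V where V: "rep st (f(2 := z)) V"
        "tt (transpose 1 2 x) 2 \<cdot> X = tt (transpose 1 2 x) 2 \<cdot> V"
        by blast
      have "rep st (f(2 := z) \<circ> transpose 1 2) (sw 1 2 \<cdot> V)"
        using rep_mult[OF rep_st_sw V(1)] n2 by blast
      moreover have "tt x 1 \<cdot> (t \<cdot> X) = tt x 1 \<cdot> (sw 1 2 \<cdot> V)"
        unfolding * sw V(2) ..
      ultimately show ?thesis
        unfolding 2 upd by blast
    next
      case 3
      show ?thesis
      proof (cases "z = f 2")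
        case True
        \<comment> \<open>Both 2 and y are vacant at this moment, so their transposition can be
          inserted. It gives y the new value f 2 = z.\<close>
        have *: "tt a y \<cdot> (t \<cdot> X) = tt a y \<cdot> (t \<cdot> (sw 2 y \<cdot> X))" if "a \<in> {1..n}" "a \<noteq> y" "a \<noteq> 2" for a
        proof -
          have "tt a y \<cdot> (t \<cdot> sw y 2) = tt a y \<cdot> t"
            using tt_tt_sw[of a y 2 1] that y n2 3 by simp
          then show ?thesis
            unfolding sw_commute[of 2 y] by (metis assoc)
        qed
        have "tt 2 y \<cdot> t = tt 1 y \<cdot> t"
          using tt_T[of 2 y] tt_T[of 1 y] y n2 3 by simp
        then have "tt 2 y \<cdot> (t \<cdot> Z) = tt 1 y \<cdot> (t \<cdot> Z)" for Z
          by (simp flip: assoc)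
        with * n2 3 x xy have "tt x y \<cdot> (t \<cdot> X) = tt x y \<cdot> (t \<cdot> (sw 2 y \<cdot> X))"
          by (cases "x = 2") auto
        moreover have "rep st (f \<circ> transpose 2 y \<circ> letter_map T) (t \<cdot> (sw 2 y \<cdot> X))"
          using y n2 by (intro rep_mult rep_st_t rep_st_sw rep_step(2))
        moreover have "f \<circ> transpose 2 y \<circ> letter_map T = (f \<circ> letter_map T)(y := z)"
          using True 3 by (auto simp: fun_eq_iff transpose_def)
        ultimately show ?thesis
          by metis
      next
        case False
        have "letter_map T x \<in> {1..n}" "letter_map T x \<noteq> y"
          using x xy 3 by auto
        then obtain V where V: "rep st (f(y := z)) V"
          "tt (letter_map T x) y \<cdot> X = tt (letter_map T x) y \<cdot> V"
          using IH[of "letter_map T x" y] False y by blast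
        have "tt x y \<cdot> (t \<cdot> Z) = t \<cdot> (tt (letter_map T x) y \<cdot> Z)" for Z
          using tt_T[of x y] x y xy 3 by (metis assoc)
        then have "tt x y \<cdot> (t \<cdot> X) = tt x y \<cdot> (t \<cdot> V)"
          using V(2) by simp
        moreover have "rep st (f(y := z) \<circ> letter_map T) (t \<cdot> V)"
          by (intro rep_mult rep_st_t V(1))
        moreover have "f(y := z) \<circ> letter_map T = (f \<circ> letter_map T)(y := z)"
          using 3 by (auto simp: fun_eq_iff)
        ultimately show ?thesis
          by metis
      qed
    qed
    then show ?thesis
      unfolding 1 .
  next
    case (2 k)
    let ?p = "transpose k (k + 1)"
    have p: "?p permutes {1..n}"
      using 2 by (intro permutes_swap_id)
    have im: "f ` {1..n} = (f \<circ> ?p) ` {1..n}"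
      by (simp only: image_comp[symmetric] permutes_image[OF p])
    have "\<exists>V. rep st (f(?p y := z)) V \<and> tt (?p x) (?p y) \<cdot> X = tt (?p x) (?p y) \<cdot> V"
      using rep_step.prems permutes_in_image[OF p] permutes_inj[OF p] unfolding 2(7) im[symmetric]
      by (intro rep_step.IH) (simp_all only: inj_eq not_False_eq_True)
    then obtain V where V: "rep st (f(?p y := z)) V" "tt (?p x) (?p y) \<cdot> X = tt (?p x) (?p y) \<cdot> V"
      by blast
    have sw: "tt x y \<cdot> (sw k (k + 1) \<cdot> Y) = sw k (k + 1) \<cdot> (tt (?p x) (?p y) \<cdot> Y)" for Y
      using tt_P[OF p x y xy] by (metis assoc)
    have "rep st (f(?p y := z) \<circ> ?p) (sw k (k + 1) \<cdot> V)"
      by (intro rep_mult rep_st_P p V(1))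
    moreover have "f(?p y := z) \<circ> ?p = (f \<circ> ?p)(y := z)"
      by (auto simp: fun_eq_iff inj_eq[OF permutes_inj[OF p]])
    moreover have "tt x y \<cdot> (sw k (k + 1) \<cdot> X) = tt x y \<cdot> (sw k (k + 1) \<cdot> V)"
      unfolding sw V(2) ..
    ultimately show ?thesis
      unfolding 2(6,7) by metis
  qed
qed simp

text \<open>T identifies 1 and 2, so it cannot be the first letter of a word with injective action;
  removing a leading transposition keeps the action injective.\<close>

lemma rep_inj: "rep st f X \<Longrightarrow> inj_on f {1..n} \<Longrightarrow> rep (swaps 1 n) f X"
proof (induction rule: rep.induct)
  case (rep_step c f X)
  from rep_step(1) show ?case
  proof (cases rule: letter_cases)
    case 1
    then have "(f \<circ> letter_map c) 1 = (f \<circ> letter_map c) 2"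
      by simp
    from inj_onD[OF rep_step.prems this] n have "(1::nat) = 2"
      by simp
    then show ?thesis
      by simp
  next
    case (2 k)
    have p: "letter_map c permutes {1..n}"
      unfolding 2(7) using 2(4,5) by (rule permutes_swap_id)
    have "inj_on f (letter_map c ` {1..n})"
      using rep_step.prems by (rule inj_on_imageI)
    then have "inj_on f {1..n}"
      by (simp only: permutes_image[OF p])
    with rep_step.IH show ?thesis
      using 2 by (intro rep.rep_step) (simp_all add: swaps_def)
  qed
qed (rule rep_neutral)

text \<open>Redirecting y to the missing value z loses no value, since f y is still attained at x.
  So the image grows, which is the descent behind \<open>rep_unique\<close> and
  \<open>rep_exists\<close>.\<close>

lemma defect_decrease:
  assumes "self_map f" "\<not> inj_on f {1..n}"
  obtains x y z where "x \<in> {1..n}" "y \<in> {1..n}" "x \<noteq> y" "f x = f y" "z \<in> {1..n}" "z \<notin> f ` {1..n}"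
    "self_map (f(y := z))" "n - card (f(y := z) ` {1..n}) < n - card (f ` {1..n})"
proof -
  obtain x y where xy: "x \<in> {1..n}" "y \<in> {1..n}" "x \<noteq> y" "f x = f y"
    using assms(2) by (auto simp: inj_on_def)
  have sub: "f ` {1..n} \<subseteq> {1..n}"
    using assms(1) self_mapD by blast
  have "card (f ` {1..n}) \<noteq> n"
    using assms(2) eq_card_imp_inj_on[of "{1..n}" f] by auto
  then have "f ` {1..n} \<noteq> {1..n}"
    by auto
  with sub obtain z where z: "z \<in> {1..n}" "z \<notin> f ` {1..n}"
    by blast
  have "insert z (f ` {1..n}) \<subseteq> f(y := z) ` {1..n}"
  proof
    fix v assume "v \<in> insert z (f ` {1..n})"
    then consider "v = z" | k where "k \<in> {1..n}" "v = f k"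
      by blast
    then show "v \<in> f(y := z) ` {1..n}"
    proof cases
      case 1
      with xy(2) show ?thesis
        by (intro image_eqI[of _ _ y]) simp_all
    next
      case 2
      with xy show ?thesis
        by (cases "k = y"; intro image_eqI[of _ _ "if k = y then x else k"]) simp_all
    qed
  qed
  then have "card (insert z (f ` {1..n})) \<le> card (f(y := z) ` {1..n})"
    by (intro card_mono) auto
  moreover have "card (insert z (f ` {1..n})) = Suc (card (f ` {1..n}))"
    using z by (intro card_insert_disjoint) auto
  moreover have "card (insert z (f ` {1..n})) \<le> card {1..n}"
    using sub z by (intro card_mono) auto
  ultimately have "n - card (f(y := z) ` {1..n}) < n - card (f ` {1..n})"
    by simp
  moreover have "self_map (f(y := z))"
    using assms(1) z xy by (auto simp: self_map_def)
  ultimately show thesis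
    using that[OF xy z] by blast
qed

lemma rep_unique: "rep st f X \<Longrightarrow> rep st f Y \<Longrightarrow> X = Y"
proof (induction "n - card (f ` {1..n})" arbitrary: f X Y rule: less_induct)
  case less
  show ?case
  proof (cases "inj_on f {1..n}")
    case True
    with less.prems show ?thesis
      using rep_swaps_unique[of 1 n] rep_inj by blast
  next
    case False
    obtain x y z where xyz: "x \<in> {1..n}" "y \<in> {1..n}" "x \<noteq> y" "f x = f y"
      "z \<in> {1..n}" "z \<notin> f ` {1..n}" "self_map (f(y := z))"
      "n - card (f(y := z) ` {1..n}) < n - card (f ` {1..n})"
      by (rule defect_decrease[OF rep_self_map[OF less.prems(1)] False])
    obtain V W where V: "rep st (f(y := z)) V" "tt x y \<cdot> X = tt x y \<cdot> V"
      and W: "rep st (f(y := z)) W" "tt x y \<cdot> Y = tt x y \<cdot> W"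
      using tt_move[OF less.prems(1) xyz(1-3,5,6)] tt_move[OF less.prems(2) xyz(1-3,5,6)] by blast
    have "V = W"
      using less.hyps[OF xyz(8) V(1) W(1)] .
    then show ?thesis
      using tt_absorb[OF less.prems(1) xyz(1-4)] tt_absorb[OF less.prems(2) xyz(1-4)] V(2) W(2)
      by simp
  qed
qed

lemma rep_exists: "self_map f \<Longrightarrow> \<exists>X. rep st f X"
proof (induction "n - card (f ` {1..n})" arbitrary: f rule: less_induct)
  case less
  show ?case
  proof (cases "inj_on f {1..n}")
    case True
    then have "f permutes {1..n}"
      using less.prems unfolding self_map_def
      by (intro bij_imp_permutes bij_betw_imageI endo_inj_surj) auto
    then show ?thesis
      using rep_st_P by blast
  next
    case False
    obtain x y z where xyz: "x \<in> {1..n}" "y \<in> {1..n}" "x \<noteq> y" "f x = f y"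
      "z \<in> {1..n}" "z \<notin> f ` {1..n}" "self_map (f(y := z))"
      "n - card (f(y := z) ` {1..n}) < n - card (f ` {1..n})"
      by (rule defect_decrease[OF less.prems False])
    obtain X where "rep st (f(y := z)) X"
      using less.hyps[OF xyz(8,7)] by blast
    then have "rep st (f(y := z) \<circ> id(y := x)) (tt x y \<cdot> X)"
      by (rule rep_mult[OF rep_st_tt[OF xyz(1-3)]])
    \<comment> \<open>y is first sent to x, where the modified map still takes the value f x = f
      y.\<close>
    moreover have "f(y := z) \<circ> id(y := x) = f"
      using xyz by (auto simp: fun_eq_iff)
    ultimately show ?thesis
      by metis
  qed
qed

section \<open>Normal form: a transformation times commuting idempotents\<close>

definition F :: "(nat \<Rightarrow> nat) \<Rightarrow> 'a" where
  "F f = (THE X. rep st f X)"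

lemma F_eqI: "rep st f X \<Longrightarrow> F f = X"
  unfolding F_def by (rule the_equality) (simp_all only: rep_unique[of f _ X])

lemma rep_F: "self_map f \<Longrightarrow> rep st f (F f)"
  using rep_exists[of f] F_eqI[of f] by metis

lemma F_comp: "rep st f X \<Longrightarrow> self_map h \<Longrightarrow> F (h \<circ> f) = X \<cdot> F h"
  by (intro F_eqI rep_mult rep_F)

lemma ee_rep: "rep st f X \<Longrightarrow> i \<in> {1..n} \<Longrightarrow> j \<in> {1..n} \<Longrightarrow> ee i j \<cdot> X = X \<cdot> ee (f i) (f j)"
proof (induction arbitrary: i j rule: rep.induct)
  case (rep_step c f X)
  have "ee i j \<cdot> g c = g c \<cdot> ee (letter_map c i) (letter_map c j)"
    using rep_step(1)
  proof (cases rule: letter_cases)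
    case 1
    then show ?thesis
      using ee_T[OF rep_step.prems] by simp
  next
    case (2 k)
    then show ?thesis
      using ee_sw[OF rep_step.prems, of k "k + 1"] by simp
  qed
  then have "ee i j \<cdot> (g c \<cdot> X) = g c \<cdot> (ee (letter_map c i) (letter_map c j) \<cdot> X)"
    by (metis assoc)
  also have "\<dots> = g c \<cdot> (X \<cdot> ee (f (letter_map c i)) (f (letter_map c j)))"
    using rep_step.prems self_mapD[OF self_map_letter[OF rep_step(1)]] by (simp only: rep_step.IH)
  finally show ?case
    by (simp add: assoc)
qed simp

definition EL :: "(nat \<times> nat) list \<Rightarrow> 'a" where
  "EL L = foldr (\<lambda>(i, j) x. ee i j \<cdot> x) L neutral"

lemma EL_simps [simp]: "EL [] = neutral" "EL ((i, j) # L) = ee i j \<cdot> EL L"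
  by (simp_all add: EL_def)

lemma ee_EL_commute:
  "set L \<subseteq> {1..n} \<times> {1..n} \<Longrightarrow> i \<in> {1..n} \<Longrightarrow> j \<in> {1..n} \<Longrightarrow> ee i j \<cdot> EL L = EL L \<cdot> ee i j"
proof (induction L)
  case (Cons kl L)
  obtain k l where kl: "kl = (k, l)"
    by (cases kl)
  have "ee i j \<cdot> (ee k l \<cdot> EL L) = ee k l \<cdot> (ee i j \<cdot> EL L)"
    using Cons.prems kl by (intro left_commuteI ee_ee) auto
  with Cons kl show ?case
    by (simp add: assoc)
qed simp

lemma ee_EL_member:
  "set L \<subseteq> {1..n} \<times> {1..n} \<Longrightarrow> (i, j) \<in> set L \<Longrightarrow> ee i j \<cdot> EL L = EL L"
proof (induction L)
  case (Cons kl L)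
  obtain k l where kl: "kl = (k, l)"
    by (cases kl)
  have ij: "i \<in> {1..n}" "j \<in> {1..n}" and k: "k \<in> {1..n}" "l \<in> {1..n}"
    using Cons.prems kl by auto
  show ?case
  proof (cases "(i, j) = kl")
    case True
    have "ee i j \<cdot> ee i j = ee i j"
      using ij ee_idem by (cases "i = j") auto
    with True kl show ?thesis
      by (simp flip: assoc)
  next
    case False
    have "ee i j \<cdot> (ee k l \<cdot> EL L) = ee k l \<cdot> (ee i j \<cdot> EL L)"
      using ij k by (intro left_commuteI ee_ee)
    with Cons kl False show ?thesis
      by auto
  qed
qed simp

lemma ee_absorb_trans:
  assumes "i \<in> {1..n}" "j \<in> {1..n}" "k \<in> {1..n}" "ee i j \<cdot> X = X" "ee j k \<cdot> X = X"
  shows "ee i k \<cdot> X = X"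
proof (cases "distinct [i, j, k]")
  case True
  have "X = ee i j \<cdot> ee j k \<cdot> X"
    using assms by (simp add: assoc)
  also have "\<dots> = ee i k \<cdot> (ee i j \<cdot> X)"
    using assms True ee_ee_chain[of i j k] ee_ee[of i j i k] by (simp add: assoc)
  finally show ?thesis
    using assms by simp
qed (use assms in auto)

text \<open>The pairs absorbed by \<open>EL L\<close> form an equivalence relation containing L, by
  \<open>ee_commute\<close> and \<open>ee_absorb_trans\<close>.\<close>

lemma ee_EL_absorb:
  assumes L: "set L \<subseteq> {1..n} \<times> {1..n}" and "eqv (set L) i j"
  shows "ee i j \<cdot> EL L = EL L"
proof -
  \<comment> \<open>\<open>eqv\<close> is reflexive on all of \<open>nat\<close>, while the rules
    for \<open>ee\<close> concern {1..n}; the first disjunct covers the remaining points.\<close>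
  have "i = j \<or> i \<in> {1..n} \<and> j \<in> {1..n} \<and> ee i j \<cdot> EL L = EL L"
    using assms(2)
  proof (rule eqv_least)
    fix x y assume "(x, y) \<in> set L"
    with L ee_EL_member[OF L this]
    show "x = y \<or> x \<in> {1..n} \<and> y \<in> {1..n} \<and> ee x y \<cdot> EL L = EL L"
      by auto
  next
    fix x y assume "x = y \<or> x \<in> {1..n} \<and> y \<in> {1..n} \<and> ee x y \<cdot> EL L = EL L"
    then show "y = x \<or> y \<in> {1..n} \<and> x \<in> {1..n} \<and> ee y x \<cdot> EL L = EL L"
      using ee_commute[of x y] by auto
  next
    fix x y z
    assume "x = y \<or> x \<in> {1..n} \<and> y \<in> {1..n} \<and> ee x y \<cdot> EL L = EL L"
      "y = z \<or> y \<in> {1..n} \<and> z \<in> {1..n} \<and> ee y z \<cdot> EL L = EL L"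
    then show "x = z \<or> x \<in> {1..n} \<and> z \<in> {1..n} \<and> ee x z \<cdot> EL L = EL L"
      using ee_absorb_trans[of x y z "EL L"] by blast
  qed simp
  then show ?thesis
    by auto
qed

lemma EL_commute:
  assumes "set L \<subseteq> {1..n} \<times> {1..n}" "set M \<subseteq> {1..n} \<times> {1..n}"
  shows "EL L \<cdot> EL M = EL M \<cdot> EL L"
  using assms(1)
proof (induction L)
  case (Cons kl L)
  obtain k l where kl: "kl = (k, l)"
    by (cases kl)
  have "EL (kl # L) \<cdot> EL M = ee k l \<cdot> (EL M \<cdot> EL L)"
    using Cons kl by (simp add: assoc)
  also have "\<dots> = EL M \<cdot> (ee k l \<cdot> EL L)"
    using Cons.prems kl by (intro left_commuteI ee_EL_commute assms(2)) auto
  finally show ?case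
    using kl by simp
qed simp

lemma EL_absorb:
  assumes M: "set M \<subseteq> {1..n} \<times> {1..n}" and "\<And>i j. (i, j) \<in> set L \<Longrightarrow> eqv (set M) i j"
  shows "EL L \<cdot> EL M = EL M"
  using assms(2)
proof (induction L)
  case (Cons kl L)
  obtain k l where kl: "kl = (k, l)"
    by (cases kl)
  with Cons show ?case
    using ee_EL_absorb[OF M, of k l] by (simp add: assoc)
qed simp

text \<open>Each product absorbs the other and they commute, so both equal their common
  product.\<close>

lemma EL_eqI:
  assumes "set L \<subseteq> {1..n} \<times> {1..n}" "set M \<subseteq> {1..n} \<times> {1..n}"
    and "\<And>i j. (i, j) \<in> set L \<Longrightarrow> eqv (set M) i j" "\<And>i j. (i, j) \<in> set M \<Longrightarrow> eqv (set L) i j"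
  shows "EL L = EL M"
  using EL_absorb[of M L] EL_absorb[of L M] EL_commute[of L M] assms by metis

text \<open>With i = f x, \<open>EL L\<close> absorbs \<open>ee i j\<close> and hence, as te = e,
  also \<open>tt i j\<close>. The maps f and f(x := j) become equal once j is sent to i, so the two
  sides agree.\<close>

lemma F_EL_update:
  assumes L: "set L \<subseteq> {1..n} \<times> {1..n}" and f: "self_map f" and x: "x \<in> {1..n}" and j: "j \<in> {1..n}"
    and "eqv (set L) (f x) j"
  shows "F (f(x := j)) \<cdot> EL L = F f \<cdot> EL L"
proof (cases "f x = j")
  case True
  then have "f(x := j) = f"
    by auto
  then show ?thesis
    by simp
next
  case False
  let ?i = "f x"
  have i: "?i \<in> {1..n}"
    using self_mapD[OF f x] .
  have "tt ?i j \<cdot> (ee ?i j \<cdot> EL L) = ee ?i j \<cdot> EL L"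
    using tt_ee[OF i j False] by (simp flip: assoc)
  then have tt: "tt ?i j \<cdot> EL L = EL L"
    using ee_EL_absorb[OF L assms(5)] by simp
  have rep: "rep st (id(j := ?i)) (tt ?i j)"
    using i j False by (rule rep_st_tt)
  have eq: "F h \<cdot> EL L = F (id(j := ?i) \<circ> h) \<cdot> EL L" if "self_map h" for h
    using F_eqI[OF rep_mult[OF rep_F[OF that] rep]] tt by (simp add: assoc)
  have upd: "self_map (f(x := j))"
    using f x j by (auto simp: self_map_def)
  have "id(j := ?i) \<circ> f(x := j) = id(j := ?i) \<circ> f"
    by (auto simp: fun_eq_iff)
  then show ?thesis
    using eq[OF f] eq[OF upd] by simp
qed

text \<open>The values of f are replaced by those of h one point at a time; D is the set of points
  already treated.\<close>

lemma F_EL_cong: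
  assumes L: "set L \<subseteq> {1..n} \<times> {1..n}" and f: "self_map f" and h: "self_map h"
    and eqv: "\<And>x. x \<in> {1..n} \<Longrightarrow> eqv (set L) (f x) (h x)"
  shows "F f \<cdot> EL L = F h \<cdot> EL L"
proof -
  have "self_map (\<lambda>x. if x \<in> D then h x else f x) \<and>
      F (\<lambda>x. if x \<in> D then h x else f x) \<cdot> EL L = F f \<cdot> EL L"
    if "finite D" "D \<subseteq> {1..n}" for D
    using that
  proof induction
    case empty
    then show ?case
      using f by simp
  next
    case (insert y D)
    let ?k = "\<lambda>x. if x \<in> D then h x else f x"
    have k: "self_map ?k" "F ?k \<cdot> EL L = F f \<cdot> EL L"
      using insert by auto
    have upd: "?k(y := h y) = (\<lambda>x. if x \<in> insert y D then h x else f x)"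
      by auto
    have y: "y \<in> {1..n}"
      using insert by simp
    have "F (?k(y := h y)) \<cdot> EL L = F ?k \<cdot> EL L"
      using insert eqv[OF y] by (intro F_EL_update L k(1) y self_mapD[OF h]) simp
    moreover have "self_map (?k(y := h y))"
      using k(1) self_mapD[OF h y] y by (auto simp: self_map_def)
    ultimately show ?case
      using k(2) unfolding upd by simp
  qed
  from this[of "{1..n}"] have "F (\<lambda>x. if x \<in> {1..n} then h x else f x) \<cdot> EL L = F f \<cdot> EL L"
    by simp
  moreover have "(\<lambda>x. if x \<in> {1..n} then h x else f x) = h"
    using f h by (auto simp: fun_eq_iff self_map_def)
  ultimately show ?thesis
    by simp
qed

lemma alphabet_cases: "c \<in> alphabet n \<Longrightarrow> c = E \<or> c \<in> st"
  by (auto simp: alphabet_def swaps_def)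

lemma st_alphabet: "st \<subseteq> alphabet n"
  by (auto simp: alphabet_def swaps_def)

lemma self_map_act: "u \<in> lists (alphabet n) \<Longrightarrow> self_map (act u)"
proof (induction u)
  case Nil
  then show ?case
    by (simp add: self_map_def)
next
  case (Cons c u)
  then have "self_map (letter_map c)"
    using alphabet_cases[of c] self_map_letter[of c] by (auto simp: self_map_def)
  with Cons show ?case
    by (simp only: act.simps) (intro self_map_comp; simp)
qed

lemma word_normal_form:
  "u \<in> lists (alphabet n) \<Longrightarrow> foldr (\<lambda>c x. g c \<cdot> x) u neutral = F (act u) \<cdot> EL (pairs u)"
proof (induction u)
  case Nil
  then show ?case
    using F_eqI[OF rep_neutral] by (simp add: id_def)
next
  case (Cons c u)
  have u: "self_map (act u)"
    using Cons by (intro self_map_act) simp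
  have IH: "foldr (\<lambda>c x. g c \<cdot> x) (c # u) neutral = g c \<cdot> (F (act u) \<cdot> EL (pairs u))"
    using Cons by simp
  from Cons.prems consider "c = E" | "c \<in> st"
    using alphabet_cases by auto
  then show ?case
  proof cases
    case 1
    have "e \<cdot> F (act u) = F (act u) \<cdot> ee (act u 1) (act u 2)"
      using ee_rep[OF rep_F[OF u], of 1 2] n by simp
    then have "e \<cdot> (F (act u) \<cdot> EL (pairs u)) = F (act u) \<cdot> (ee (act u 1) (act u 2) \<cdot> EL (pairs u))"
      by (metis assoc)
    with IH 1 show ?thesis
      by simp
  next
    case 2
    then have "c \<noteq> E"
      by (auto simp: swaps_def)
    have "F (act u \<circ> letter_map c) = g c \<cdot> F (act u)"
      using 2 u by (intro F_comp rep_letter)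
    then have "F (act (c # u)) \<cdot> EL (pairs u) = g c \<cdot> (F (act u) \<cdot> EL (pairs u))"
      by (simp only: act.simps assoc)
    with IH \<open>c \<noteq> E\<close> show ?thesis
      by (simp only: pairs.simps if_False append_Nil)
  qed
qed

text \<open>The hypotheses are the right-hand side of \<open>presentation_map_eq_iff\<close>: words
  with the same partition have the same value in every monoid satisfying the relations.\<close>

lemma word_eqI:
  assumes u: "u \<in> lists (alphabet n)" and v: "v \<in> lists (alphabet n)"
    and eq: "\<forall>i\<in>{1..n}. \<forall>j\<in>{1..n}. eqv (set (pairs u)) i j \<longleftrightarrow> eqv (set (pairs v)) i j"
    and act: "\<forall>i\<in>{1..n}. eqv (set (pairs v)) (act u i) (act v i)"
  shows "foldr (\<lambda>c x. g c \<cdot> x) u neutral = foldr (\<lambda>c x. g c \<cdot> x) v neutral"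
proof -
  note in_u = pairs_in[OF n u] and in_v = pairs_in[OF n v]
  have "EL (pairs u) = EL (pairs v)"
  proof (rule EL_eqI[OF in_u in_v])
    fix i j
    show "eqv (set (pairs v)) i j" if ij: "(i, j) \<in> set (pairs u)"
      using eqv_base[OF ij] subsetD[OF in_u ij] eq by blast
    show "eqv (set (pairs u)) i j" if ij: "(i, j) \<in> set (pairs v)"
      using eqv_base[OF ij] subsetD[OF in_v ij] eq by blast
  qed
  moreover have "F (act u) \<cdot> EL (pairs v) = F (act v) \<cdot> EL (pairs v)"
    using act by (intro F_EL_cong in_v self_map_act u v) blast
  ultimately show ?thesis
    by (simp add: word_normal_form u v)
qed

section \<open>Words with a prescribed code\<close>

lemma rep_word: "rep A f X \<Longrightarrow> \<exists>u\<in>lists A. act u = f"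
proof (induction rule: rep.induct)
  case rep_neutral
  show ?case
    by (rule bexI[of _ "[]"]) simp_all
next
  case (rep_step c f X)
  then obtain u where "u \<in> lists A" "act u = f"
    by blast
  with rep_step(1) show ?case
    by (intro bexI[of _ "c # u"]) simp_all
qed

lemma word_of_self_map:
  assumes "self_map f"
  obtains u where "u \<in> lists (alphabet n)" "act u = f" "pairs u = []"
proof -
  obtain u where u: "u \<in> lists st" "act u = f"
    using rep_word[OF rep_F[OF assms]] by blast
  have "pairs v = []" if "v \<in> lists st" for v
    using that by (induction v) (auto simp: swaps_def)
  moreover have "u \<in> lists (alphabet n)"
    using u(1) lists_mono[OF st_alphabet] by blast
  ultimately show thesis
    using that u by blast
qed

text \<open>The word for e conjugated by a permutation p taking 1, 2 to i, j: the outer actions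
  cancel, and the part after \<open>E\<close> carries its pair to (i, j).\<close>

lemma word_of_pair:
  assumes "i \<in> {1..n}" "j \<in> {1..n}" "i \<noteq> j"
  obtains u where "u \<in> lists (alphabet n)" "act u = id" "pairs u = [(i, j)]"
proof -
  obtain p where p: "p permutes {1..n}" "p 1 = i" "p 2 = j"
    using exists_permutation_2[OF assms] by blast
  obtain u where u: "u \<in> lists (alphabet n)" "act u = p" "pairs u = []"
    by (rule word_of_self_map[OF self_map_permutes[OF p(1)]])
  obtain v where v: "v \<in> lists (alphabet n)" "act v = inv_into UNIV p" "pairs v = []"
    by (rule word_of_self_map[OF self_map_permutes[OF permutes_inv[OF p(1)]]])
  have "v @ [E] @ u \<in> lists (alphabet n)"
    using u v by (simp add: alphabet_def)
  moreover have "act (v @ [E] @ u) = id"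
    using u v by (simp add: act_append permutes_inv_o[OF p(1)])
  moreover have "pairs (v @ [E] @ u) = [(i, j)]"
    using u v p by (simp add: pairs_append)
  ultimately show thesis
    by (rule that)
qed

text \<open>Words with identity action do not disturb each other's pairs, so concatenation collects
  them. A pair with equal entries is skipped, so equivalences are compared rather than sets of
  pairs.\<close>

lemma word_of_pairs:
  "set L \<subseteq> {1..n} \<times> {1..n} \<Longrightarrow>
    \<exists>u\<in>lists (alphabet n). act u = id \<and> eqv (set (pairs u)) = eqv (set L)"
proof (induction L)
  case Nil
  show ?case
    by (rule bexI[of _ "[]"]) simp_all
next
  case (Cons ij L)
  obtain i j where ij: "ij = (i, j)" "i \<in> {1..n}" "j \<in> {1..n}"
    using Cons.prems by auto
  obtain u where u: "u \<in> lists (alphabet n)" "act u = id" "eqv (set (pairs u)) = eqv (set L)"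
    using Cons.IH Cons.prems unfolding list.simps(15) insert_subset by blast
  have mono: "eqv (insert (i, j) M) x y" if "eqv M x y" for M x y
    using that by (rule eqv_mono) (auto intro: eqv_base)
  show ?case
  proof (cases "i = j")
    case True
    have "eqv (set (ij # L)) = eqv (set L)"
      using ij True by (intro eqv_cong) (auto intro: eqv_base)
    with u show ?thesis
      by metis
  next
    case False
    obtain v where v: "v \<in> lists (alphabet n)" "act v = id" "pairs v = [(i, j)]"
      by (rule word_of_pair[OF ij(2,3) False])
    have "pairs (v @ u) = (i, j) # pairs u"
      using u v by (simp add: pairs_append)
    moreover have "eqv (set ((i, j) # pairs u)) = eqv (set (ij # L))"
    proof (rule eqv_cong)
      fix x y assume "(x, y) \<in> set ((i, j) # pairs u)"
      then have "(x, y) = (i, j) \<or> eqv (set L) x y"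
        using eqv_base[of x y "set (pairs u)"] u(3) by auto
      then show "eqv (set (ij # L)) x y"
        using mono[of "set L" x y] ij by (auto intro: eqv_base)
    next
      fix x y assume "(x, y) \<in> set (ij # L)"
      then have "(x, y) = (i, j) \<or> eqv (set (pairs u)) x y"
        using eqv_base[of x y "set L"] u(3) ij by auto
      then show "eqv (set ((i, j) # pairs u)) x y"
        using mono[of "set (pairs u)" x y] by (auto intro: eqv_base)
    qed
    moreover have "act (v @ u) = id"
      using u v by (simp add: act_append)
    ultimately show ?thesis
      using u v by (intro bexI[of _ "v @ u"]) simp_all
  qed
qed

end

section \<open>The presentation\<close>

text \<open>
  The monoid presented by \<open>relations n\<close>, acting from the right on its own elements: a word is
  represented by the transformation of the set of congruence classes that it induces.
\<close>

definition word_class :: "nat \<Rightarrow> letter list \<Rightarrow> letter list set" where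
  "word_class n u = generated_congruence (free_monoid (alphabet n)) (relations n) `` {u}"

text \<open>A set that is no congruence class is left fixed, so that the relations hold as
  equalities of functions on the whole type.\<close>

definition right_mult :: "nat \<Rightarrow> letter \<Rightarrow> letter list set \<Rightarrow> letter list set" where
  "right_mult n c A = (if \<exists>x\<in>lists (alphabet n). A = word_class n x
     then word_class n ((SOME x. x \<in> lists (alphabet n) \<and> A = word_class n x) @ [c]) else A)"

lemma word_class_eq_iff:
  assumes "u \<in> lists (alphabet n)"
  shows "word_class n u = word_class n v \<longleftrightarrow>
    (u, v) \<in> generated_congruence (free_monoid (alphabet n)) (relations n)"
proof
  assume "word_class n u = word_class n v"
  moreover have "u \<in> word_class n u"
    using assms by (auto simp: word_class_def free_monoid_def intro: generated_congruence.refl)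
  ultimately show "(u, v) \<in> generated_congruence (free_monoid (alphabet n)) (relations n)"
    unfolding word_class_def by (blast intro: generated_congruence.sym)
next
  assume "(u, v) \<in> generated_congruence (free_monoid (alphabet n)) (relations n)"
  then show "word_class n u = word_class n v"
    unfolding word_class_def by (blast intro: generated_congruence.sym generated_congruence.trans)
qed

lemma generated_congruence_append:
  assumes "(u, v) \<in> generated_congruence (free_monoid (alphabet n)) (relations n)"
    and "(u', v') \<in> generated_congruence (free_monoid (alphabet n)) (relations n)"
  shows "(u @ u', v @ v') \<in> generated_congruence (free_monoid (alphabet n)) (relations n)"
  using generated_congruence.mult[OF assms] by (simp add: free_monoid_def)

lemma generated_congruence_refl:
  "u \<in> lists (alphabet n) \<Longrightarrow>
    (u, u) \<in> generated_congruence (free_monoid (alphabet n)) (relations n)"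
  by (rule generated_congruence.refl) (simp add: free_monoid_def)

lemma right_mult_word_class:
  assumes x: "x \<in> lists (alphabet n)" and c: "c \<in> alphabet n"
  shows "right_mult n c (word_class n x) = word_class n (x @ [c])"
proof -
  let ?P = "\<lambda>y. y \<in> lists (alphabet n) \<and> word_class n x = word_class n y"
  define y where "y = (SOME y. ?P y)"
  have "?P y"
    unfolding y_def by (rule someI[of ?P x]) (use x in simp)
  then have "(x @ [c], y @ [c]) \<in> generated_congruence (free_monoid (alphabet n)) (relations n)"
    using x c word_class_eq_iff[OF x] by (intro generated_congruence_append generated_congruence_refl) auto
  then have "word_class n (x @ [c]) = word_class n (y @ [c])"
    using x c by (subst word_class_eq_iff) auto
  moreover have "\<exists>y\<in>lists (alphabet n). word_class n x = word_class n y"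
    using x by blast
  ultimately show ?thesis
    unfolding right_mult_def y_def by simp
qed

lemma foldr_right_mult_word_class:
  "u \<in> lists (alphabet n) \<Longrightarrow> x \<in> lists (alphabet n) \<Longrightarrow>
    foldr (\<lambda>c h. h \<circ> right_mult n c) u id (word_class n x) = word_class n (x @ u)"
proof (induction u arbitrary: x)
  case (Cons c u)
  then show ?case
    using Cons.IH[of "x @ [c]"] by (simp add: right_mult_word_class)
qed simp

lemma foldr_right_mult_other:
  "\<nexists>x. x \<in> lists (alphabet n) \<and> A = word_class n x \<Longrightarrow>
    foldr (\<lambda>c h. h \<circ> right_mult n c) u id A = A"
proof (induction u)
  case (Cons c u)
  have "right_mult n c A = A"
    using Cons.prems unfolding right_mult_def by auto
  with Cons show ?case
    by simp
qed simp

lemma presented_right_mult: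
  assumes "2 \<le> n"
  shows "presented n (\<lambda>x y. y \<circ> x) id (right_mult n)"
proof
  fix u v assume uv: "(u, v) \<in> relations n"
  then have lists: "u \<in> lists (alphabet n)" "v \<in> lists (alphabet n)"
    by (auto simp: relations_def)
  show "foldr (\<lambda>c h. h \<circ> right_mult n c) u id = foldr (\<lambda>c h. h \<circ> right_mult n c) v id"
  proof
    fix A
    show "foldr (\<lambda>c h. h \<circ> right_mult n c) u id A = foldr (\<lambda>c h. h \<circ> right_mult n c) v id A"
    proof (cases "\<exists>x. x \<in> lists (alphabet n) \<and> A = word_class n x")
      case True
      then obtain x where x: "x \<in> lists (alphabet n)" "A = word_class n x"
        by blast
      have "(x @ u, x @ v) \<in> generated_congruence (free_monoid (alphabet n)) (relations n)"
        using x by (intro generated_congruence_append generated_congruence_refl generated_congruence.base uv)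
      then have "word_class n (x @ u) = word_class n (x @ v)"
        using x lists by (subst word_class_eq_iff) auto
      with x lists show ?thesis
        by (simp add: foldr_right_mult_word_class)
    next
      case False
      show ?thesis
        by (simp only: foldr_right_mult_other[OF False])
    qed
  qed
qed (use assms in \<open>simp_all add: comp_assoc\<close>)

lemma presentation_map_append:
  assumes n: "2 \<le> n" and u: "u \<in> lists (alphabet n)" and v: "v \<in> lists (alphabet n)"
  shows "presentation_map n (u @ v) =
    presentation_map n u \<otimes>\<^bsub>full_domain_partition_monoid n\<^esub> presentation_map n v"
proof -
  have uv: "u @ v \<in> lists (alphabet n)"
    using u v by simp
  show ?thesis
    unfolding presentation_map_encoded[OF n u] presentation_map_encoded[OF n v]
      presentation_map_encoded[OF n uv]
      partition_mult_encoded[OF act_in[OF n u] act_in[OF n v] pairs_in[OF n u] pairs_in[OF n v]]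
    by (simp add: act_append pairs_append Un_commute)
qed

theorem theorem3p32:
  fixes n :: nat
  assumes "n \<ge> 2"
  shows "has_monoid_presentation (full_domain_partition_monoid n)
           (alphabet n) (relations n) (presentation_map n)"
proof -
  note n = assms
  interpret presented n "\<lambda>x y. y \<circ> x" id "right_mult n"
    using n by (rule presented_right_mult)
  let ?C = "generated_congruence (free_monoid (alphabet n)) (relations n)"
  have carrier: "presentation_map n u \<in> carrier (full_domain_partition_monoid n)"
    if "u \<in> lists (alphabet n)" for u
    using that by (simp only: presentation_map_encoded[OF n] encoded_in_carrier[OF act_in[OF n]])
  have hom: "presentation_map n \<in> hom (free_monoid (alphabet n)) (full_domain_partition_monoid n)"
    using carrier presentation_map_append[OF n] by (intro homI) (simp_all add: free_monoid_def)
  have surj: "a \<in> presentation_map n ` lists (alphabet n)"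
    if a_in: "a \<in> carrier (full_domain_partition_monoid n)" for a
  proof -
    obtain f L where a: "f ` {1..n} \<subseteq> {1..n}" "L \<subseteq> {1..n} \<times> {1..n}" "a = encoded n f L"
      "\<forall>x. x \<notin> {1..n} \<longrightarrow> f x = x"
      by (rule exists_encoded[OF a_in])
    have "self_map f"
      using a(1,4) unfolding self_map_def by blast
    then obtain u where u: "u \<in> lists (alphabet n)" "act u = f" "pairs u = []"
      by (rule word_of_self_map)
    have "finite L"
      using a(2) by (rule finite_subset) simp
    then obtain l where l: "set l = L"
      using finite_list by blast
    obtain v where v: "v \<in> lists (alphabet n)" "act v = id" "eqv (set (pairs v)) = eqv L"
      using word_of_pairs[of l] a(2) unfolding l by blast
    have uv: "u @ v \<in> lists (alphabet n)"
      using u v by simp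
    \<comment> \<open>The first word carries the map without pairs, the second the pairs with
      identity action; concatenation combines the two.\<close>
    have "presentation_map n (u @ v) = encoded n f (set (pairs v))"
      unfolding presentation_map_encoded[OF n uv] using u v by (simp add: act_append pairs_append)
    also have "\<dots> = a"
      unfolding a(3) using v(3) a(1) by (intro encoded_eqI) (auto simp: image_subset_iff)
    finally show ?thesis
      using uv by blast
  qed
  have complete: "(u, v) \<in> ?C"
    if u: "u \<in> lists (alphabet n)" and v: "v \<in> lists (alphabet n)"
      and eq: "presentation_map n u = presentation_map n v" for u v
  proof -
    have "foldr (\<lambda>c h. h \<circ> right_mult n c) u id = foldr (\<lambda>c h. h \<circ> right_mult n c) v id"
      using eq unfolding presentation_map_eq_iff[OF n u v] by (elim conjE) (rule word_eqI[OF u v])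
    \<comment> \<open>Evaluation at the class of the empty word recovers the class of each word: the
      representation is faithful.\<close>
    then have "word_class n ([] @ u) = word_class n ([] @ v)"
      using foldr_right_mult_word_class[OF u, of "[]"] foldr_right_mult_word_class[OF v, of "[]"]
      by simp
    then show ?thesis
      using word_class_eq_iff[OF u] by simp
  qed
  have sound: "u \<in> lists (alphabet n) \<and> v \<in> lists (alphabet n) \<and> presentation_map n u = presentation_map n v"
    if "(u, v) \<in> ?C" for u v
  proof -
    have uv: "u \<in> lists (alphabet n)" "v \<in> lists (alphabet n)" and "equal_codes u v"
      using equal_codes_generated_congruence[OF that] by simp_all
    then show ?thesis
      unfolding presentation_map_eq_iff[OF n uv] equal_codes_def by simp
  qed
  show ?thesis
    unfolding has_monoid_presentation_def
  proof (intro conjI)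
    show "monoid (full_domain_partition_monoid n)"
      by (rule full_domain_partition_monoid_is_monoid)
    show "relations n \<subseteq> lists (alphabet n) \<times> lists (alphabet n)"
      unfolding relations_def by blast
    show "presentation_map n [] = \<one>\<^bsub>full_domain_partition_monoid n\<^esub>"
      by (simp add: presentation_map_def word_morphism_def)
    show "presentation_map n ` lists (alphabet n) = carrier (full_domain_partition_monoid n)"
      using carrier surj by blast
    show "{(u, v). u \<in> lists (alphabet n) \<and> v \<in> lists (alphabet n) \<and>
        presentation_map n u = presentation_map n v} = ?C"
      (is "?K = _")
    proof (intro equalityI subrelI)
      fix u v assume "(u, v) \<in> ?K"
      then show "(u, v) \<in> ?C"
        by (intro complete) simp_all
    next
      fix u v assume "(u, v) \<in> ?C"
      from sound[OF this] show "(u, v) \<in> ?K"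
        by simp
    qed
  qed (rule hom)
qed

end
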